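(* Let $D$ be a $k$-partite tournament with $k$-partition $(V_1,\ldots,V_k)$ and ordered strong components $Q_1,\ldots,Q_s$ for some integers $k\ge 3$ and $s\ge 2$, and let $Q_t$ be the last nontrivial component of $D$, with $\kappa(Q_t)=3$ and $t<s$. Assume that the partite sets are labeled so that $V_i\cap V(Q_t)=U_i^{(t)}$ for $i=1,2,3$, where $U_1^{(t)},U_2^{(t)},U_3^{(t)}$ are the sets of imprimitivity of $Q_t$. Then there exist a positive integer $N$ and pairwise disjoint (possibly empty) sets $W_1,\ldots,W_7$ with union $V(D_{1\sim t})$ such that, with $G_{1,i}$ and $G_{2,i}$ ($i=1,2,3$) the graphs built from $W_1,\dots,W_7$ as defined in the context, the following holds for every $m\ge N$: - if $V(D_{t+1\sim s})\subseteq V_j$ for some $j\in\{1,2,3\}$, then $C^m(D)$ is isomorphic to $G_{1,i}\cup I[D_{t+1\sim s}]$, where $i\in\{1,2,3\}$ satisfies $i\equiv m-j+1\pmod 3$; - if there is an integer $\alpha\in\{t+1,\ldots,s-1\}$ such that $V(D_{t+1\sim\alpha})$ and $V(D_{\alpha+1\sim s})$ are partite-related to $U_j^{(t)}$ and $U_{j+1}^{(t)}$, respectively, for some $j\in\{1,2,3\}$ (identifying $U_4^{(t)}$ with $U_1^{(t)}$), then $C^m(D)$ is isomorphic to $G_{2,i}\cup I[D_{t+1\sim s}]$, where $i\in\{1,2,3\}$ satisfies $i\equiv m-j+1\pmod 3$; - otherwise (neither of the two conditions above holds), $C^m(D)$ is isomorphic to $K[D_{1\sim t}]\cup I[D_{t+1\sim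 s}]$.
   Context: All digraphs are finite with simple underlying graph. For a positive integer $m$, the $m$-step competition graph $C^m(D)$ of a digraph $D$ is the simple graph with vertex set $V(D)$ in which two distinct vertices $u,v$ are adjacent iff there is a vertex $w$ such that there are directed walks of length exactly $m$ from $u$ to $w$ and from $v$ to $w$. A $k$-partite tournament is an orientation of a complete $k$-partite graph; its $k$-partition $(V_1,\dots,V_k)$ consists of its (nonempty) partite sets. Ordered strong components of $D$ are its strong components arranged as $Q_1,\ldots,Q_s$ so that there is no arc from $Q_i$ to $Q_j$ whenever $i>j$. A strong component is trivial if it has exactly one vertex and nontrivial otherwise. The last nontrivial component is the nontrivial $Q_t$ such that $Q_i$ is trivial for every $t<i\le s$. $D_{\alpha\sim\beta}$ denotes the subdigraph induced by $\bigcup_{i=\alpha}^{\beta}V(Q_i)$. A vertex set $X$ is partite-related to a vertex set $Y$ if $X$ and $Y$ are both contained in one partite set of $D$. For a nontrivial strongly connected digraph $Q$, the index of imprimitivity $\kappa(Q)$ is the greatest common divisor of the lengths of its closed directed walks. The sets of imprimitivity of $Q$ are the nonempty sets $U_1,\dots,U_{\kappa(Q)}$ partitioning $V(Q)$ such that each arc of $Q$ goes from $U_i$ to $U_{i+1}$ for some $i$ (with $U_{\kappa(Q)+1}=U_1$); those of $Q_t$ are written $U_i^{(t)}$. It is known that if $\kappa(Q_t)=3$ then $Q_t$ is a tripartite tournament whose partite sets are its sets of imprimitivity, so the labeling assumed in the claim is always possible. For vertex-disjoint graphs, $\cup$ denotes disjoint union and $\vee$ denotes join (the union together with all edges between the two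 graphs). For a vertex set $Z$, $K[Z]$ and $I[Z]$ are the complete graph and the edgeless graph on $Z$; for a digraph $H$, $K[H]=K[V(H)]$ and $I[H]=I[V(H)]$. Definition of $G_{1,i}$ and $G_{2,i}$: given pairwise disjoint, possibly empty sets $W_1,\dots,W_7$, write $K^{(a)}=K[W_a]$. Each $G_{1,i}$ has vertex set $W_1\cup\dots\cup W_7$, each $W_a$ is a clique, and for $a\ne b$ all edges between $W_a$ and $W_b$ are present, except that there are no edges between $W_a$ and $W_b$ for the following pairs $\{a,b\}$: in $G_{1,1}$, the pairs $\{4,5\},\{5,6\},\{5,7\}$; in $G_{1,2}$, the pairs $\{2,7\},\{5,7\},\{6,7\}$; in $G_{1,3}$, the pairs $\{3,6\},\{5,6\},\{6,7\}$. Further, $V(G_{2,i})=V(G_{1,i})$ and $E(G_{2,1})=E(G_{1,1})\cup E(K^{(5)}\vee(K^{(4)}\cup K^{(7)}))$, $E(G_{2,2})=E(G_{1,2})\cup E(K^{(7)}\vee(K^{(2)}\cup K^{(6)}))$, $E(G_{2,3})=E(G_{1,3})\cup E(K^{(6)}\vee(K^{(3)}\cup K^{(5)}))$. *)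

theory Defs
  imports
    "Graph_Theory.Digraph_Component"
    "Graph_Theory.Digraph_Isomorphism"
    "HOL-Library.Disjoint_Sets"
    "HOL-Number_Theory.Cong"
begin

text \<open>
  Simple graphs are represented, as in the Graph_Theory library, by symmetric loop-free
  digraphs: an edge between \<open>u\<close> and \<open>v\<close> is the pair of arcs \<open>(u,v)\<close>, \<open>(v,u)\<close>.
  On such graphs \<^const>\<open>digraph_iso\<close> is the usual isomorphism of simple graphs.
\<close>

definition complete_graph :: "'a set \<Rightarrow> 'a pair_pre_digraph" where
  "complete_graph Z = \<lparr> pverts = Z, parcs = {(u, v). u \<in> Z \<and> v \<in> Z \<and> u \<noteq> v} \<rparr>"

definition edgeless_graph :: "'a set \<Rightarrow> 'a pair_pre_digraph" where
  "edgeless_graph Z = \<lparr> pverts = Z, parcs = {} \<rparr>"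

text \<open>The next two operations are meant for graphs with disjoint vertex sets.\<close>

definition graph_union :: "'a pair_pre_digraph \<Rightarrow> 'a pair_pre_digraph \<Rightarrow> 'a pair_pre_digraph" where
  "graph_union G H = \<lparr> pverts = pverts G \<union> pverts H, parcs = parcs G \<union> parcs H \<rparr>"

definition graph_join :: "'a pair_pre_digraph \<Rightarrow> 'a pair_pre_digraph \<Rightarrow> 'a pair_pre_digraph" where
  "graph_join G H = \<lparr> pverts = pverts G \<union> pverts H,
     parcs = parcs G \<union> parcs H \<union> pverts G \<times> pverts H \<union> pverts H \<times> pverts G \<rparr>"

definition step_competition_graph :: "nat \<Rightarrow> 'a pair_pre_digraph \<Rightarrow> 'a pair_pre_digraph" where
  "step_competition_graph m D = \<lparr> pverts = pverts D,
     parcs = {(u, v). u \<in> pverts D \<and> v \<in> pverts D \<and> u \<noteq> v \<and>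
       (\<exists>w p q. pre_digraph.awalk (with_proj D) u p w \<and> length p = m \<and>
                pre_digraph.awalk (with_proj D) v q w \<and> length q = m)} \<rparr>"

definition is_partition :: "nat \<Rightarrow> (nat \<Rightarrow> 'a set) \<Rightarrow> 'a set \<Rightarrow> bool" where
  "is_partition k V A \<longleftrightarrow>
     (\<forall>i\<in>{1..k}. V i \<noteq> {}) \<and> disjoint_family_on V {1..k} \<and> (\<Union>i\<in>{1..k}. V i) = A"

definition complete_multipartite_graph :: "nat \<Rightarrow> (nat \<Rightarrow> 'a set) \<Rightarrow> 'a pair_pre_digraph" where
  "complete_multipartite_graph k V = \<lparr> pverts = (\<Union>i\<in>{1..k}. V i),
     parcs = {(u, v). \<exists>i\<in>{1..k}. \<exists>j\<in>{1..k}. i \<noteq> j \<and> u \<in> V i \<and> v \<in> V j} \<rparr>"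

definition orientation_of :: "'a pair_pre_digraph \<Rightarrow> 'a pair_pre_digraph \<Rightarrow> bool" where
  "orientation_of D G \<longleftrightarrow> pverts D = pverts G \<and>
     parcs D \<inter> (parcs D)\<inverse> = {} \<and> parcs D \<union> (parcs D)\<inverse> = parcs G"

definition multipartite_tournament :: "nat \<Rightarrow> (nat \<Rightarrow> 'a set) \<Rightarrow> 'a pair_pre_digraph \<Rightarrow> bool" where
  "multipartite_tournament k V D \<longleftrightarrow> pair_digraph D \<and> is_partition k V (pverts D) \<and>
     orientation_of D (complete_multipartite_graph k V)"

definition partite_related :: "nat \<Rightarrow> (nat \<Rightarrow> 'a set) \<Rightarrow> 'a set \<Rightarrow> 'a set \<Rightarrow> bool" where
  "partite_related k V X Y \<longleftrightarrow> (\<exists>i\<in>{1..k}. X \<subseteq> V i \<and> Y \<subseteq> V i)"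

definition ordered_strong_components ::
    "'a pair_pre_digraph \<Rightarrow> nat \<Rightarrow> (nat \<Rightarrow> ('a, 'a \<times> 'a) pre_digraph) \<Rightarrow> bool" where
  "ordered_strong_components D s Q \<longleftrightarrow>
     bij_betw Q {1..s} (pre_digraph.sccs (with_proj D)) \<and>
     (\<forall>i\<in>{1..s}. \<forall>j\<in>{1..s}. j < i \<longrightarrow>
        \<not> (\<exists>u\<in>verts (Q i). \<exists>v\<in>verts (Q j). (u, v) \<in> parcs D))"

definition trivial_component :: "('a, 'b) pre_digraph \<Rightarrow> bool" where
  "trivial_component H \<longleftrightarrow> card (verts H) = 1"

definition last_nontrivial_component ::
    "nat \<Rightarrow> (nat \<Rightarrow> ('a, 'b) pre_digraph) \<Rightarrow> nat \<Rightarrow> bool" where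
  "last_nontrivial_component s Q t \<longleftrightarrow> t \<in> {1..s} \<and> \<not> trivial_component (Q t) \<and>
     (\<forall>i. t < i \<and> i \<le> s \<longrightarrow> trivial_component (Q i))"

text \<open>The subdigraph \<open>D\<^bsub>\<alpha>\<sim>\<beta>\<^esub>\<close> induced by the components \<open>Q \<alpha>, \<dots>, Q \<beta>\<close>.\<close>

definition component_range ::
    "'a pair_pre_digraph \<Rightarrow> (nat \<Rightarrow> ('a, 'a \<times> 'a) pre_digraph) \<Rightarrow> nat \<Rightarrow> nat \<Rightarrow>
     ('a, 'a \<times> 'a) pre_digraph" where
  "component_range D Q \<alpha> \<beta> = with_proj D \<restriction> (\<Union>i\<in>{\<alpha>..\<beta>}. verts (Q i))"

definition imprimitivity_index :: "('a, 'b) pre_digraph \<Rightarrow> nat" where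
  "imprimitivity_index Q = Gcd {length p | u p. pre_digraph.awalk Q u p u \<and> p \<noteq> []}"

definition imprimitivity_sets :: "('a, 'b) pre_digraph \<Rightarrow> (nat \<Rightarrow> 'a set) \<Rightarrow> bool" where
  "imprimitivity_sets Q U \<longleftrightarrow>
     is_partition (imprimitivity_index Q) U (verts Q) \<and>
     (\<forall>e\<in>arcs Q. \<exists>i\<in>{1..imprimitivity_index Q}.
        tail Q e \<in> U i \<and> head Q e \<in> U (i mod imprimitivity_index Q + 1))"

text \<open>
  \<open>G1_nonadjacent i\<close> lists the pairs \<open>{a, b}\<close> with no edges between \<open>W a\<close> and \<open>W b\<close> in
  \<open>G\<^bsub>1,i\<^esub>\<close>. Only \<open>i \<in> {1, 2, 3}\<close> is meaningful, here and below. As \<open>{a, a}\<close> is never listed,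
  each \<open>W a\<close> is a clique.
\<close>

definition G1_nonadjacent :: "nat \<Rightarrow> nat set set" where
  "G1_nonadjacent i =
     (if i = 1 then {{4, 5}, {5, 6}, {5, 7}}
      else if i = 2 then {{2, 7}, {5, 7}, {6, 7}}
      else {{3, 6}, {5, 6}, {6, 7}})"

definition G1 :: "nat \<Rightarrow> (nat \<Rightarrow> 'a set) \<Rightarrow> 'a pair_pre_digraph" where
  "G1 i W = \<lparr> pverts = (\<Union>a\<in>{1..7}. W a),
     parcs = {(u, v). u \<noteq> v \<and> (\<exists>a\<in>{1..7}. \<exists>b\<in>{1..7}.
       u \<in> W a \<and> v \<in> W b \<and> {a, b} \<notin> G1_nonadjacent i)} \<rparr>"

definition G2 :: "nat \<Rightarrow> (nat \<Rightarrow> 'a set) \<Rightarrow> 'a pair_pre_digraph" where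
  "G2 i W = (let K = (\<lambda>a. complete_graph (W a)) in
     \<lparr> pverts = pverts (G1 i W),
       parcs = parcs (G1 i W) \<union>
         parcs (if i = 1 then graph_join (K 5) (graph_union (K 4) (K 7))
                else if i = 2 then graph_join (K 7) (graph_union (K 2) (K 6))
                else graph_join (K 6) (graph_union (K 3) (K 5))) \<rparr>)"

end

theory Submission
  imports Defs
begin

text \<open>
  \<open>Q t\<close> is a complete tripartite digraph whose arcs rotate through its three partite sets, so a
  walk of length \<open>m\<close> from \<open>v\<close> that ends in \<open>Q t\<close> may end anywhere in the class \<open>p + m\<close> modulo 3,
  where the phase \<open>p\<close> belongs to a set of residues depending only on \<open>v\<close>, once \<open>m\<close> is large. For
  \<open>v\<close> in \<open>Q 1, \<dots>, Q t\<close> this set is nonempty, and its seven possible values define \<open>W 1, \<dots>, W 7\<close>.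
  Two such vertices with a common phase have a common prey. Otherwise they can only meet in the
  acyclic tail \<open>Q (t + 1), \<dots>, Q s\<close>, and there the prey of \<open>v\<close> is the union, over its phases \<open>p\<close>, of
  a set that depends only on \<open>p + m\<close> modulo 3: a walk that bypasses \<open>Q t\<close> can be rerouted through
  it without changing its length. If some arc of the tail does not lead from \<open>V j\<close> to
  \<open>V (j + 1)\<close> for an index \<open>j\<close> modulo 3, or if the tail meets a further partite set, then one tail
  vertex is a prey for all phases. What remains are the first two cases of the theorem.
\<close>

section \<open>Walks through the cyclic core\<close>

text \<open>\<open>col\<close> gives the partite set of a vertex and \<open>rank\<close> its strong component; component \<open>t\<close>
  is the core.\<close>

locale cyclic_core =
  fixes E :: "'a rel" and X :: "'a set" and col rank :: "'a \<Rightarrow> nat" and t s :: nat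
  assumes finite_X: "finite X"
    and arc_in: "E \<subseteq> X \<times> X"
    and arc_col: "(x, y) \<in> E \<Longrightarrow> col x \<noteq> col y"
    and arc_or: "x \<in> X \<Longrightarrow> y \<in> X \<Longrightarrow> col x \<noteq> col y \<Longrightarrow> (x, y) \<in> E \<or> (y, x) \<in> E"
    and rank_le: "x \<in> X \<Longrightarrow> rank x \<le> s"
    and rank_surj: "i \<in> {1..s} \<Longrightarrow> \<exists>x\<in>X. rank x = i"
    and t_less_s: "t < s"
    and arc_rank: "(x, y) \<in> E \<Longrightarrow> rank x \<le> rank y"
    and tail_inj: "x \<in> X \<Longrightarrow> y \<in> X \<Longrightarrow> rank x = rank y \<Longrightarrow> t < rank x \<Longrightarrow> x = y"
    and core_col: "x \<in> X \<Longrightarrow> rank x = t \<Longrightarrow> col x \<in> {1..3}"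
    and core_step: "(x, y) \<in> E \<Longrightarrow> rank x = t \<Longrightarrow> rank y = t \<Longrightarrow> [col y = Suc (col x)] (mod 3)"
    and core_ex: "i \<in> {1..3} \<Longrightarrow> \<exists>x\<in>X. rank x = t \<and> col x = i"
begin

section \<open>Arcs and walks inside the core\<close>

lemma arc_ranked: "x \<in> X \<Longrightarrow> y \<in> X \<Longrightarrow> rank x < rank y \<Longrightarrow> col x \<noteq> col y \<Longrightarrow> (x, y) \<in> E"
  using arc_or arc_rank by (meson not_less)

text \<open>The colours differ, so one of the two arcs is present; the reverse arc would advance the
  colour by 1 as well, making 2 congruent to 0 modulo 3.\<close>

lemma core_arc:
  assumes "x \<in> X" "y \<in> X" "rank x = t" "rank y = t" "[col y = Suc (col x)] (mod 3)"
  shows "(x, y) \<in> E"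
proof -
  have "\<not> [n = Suc n] (mod 3)" "\<not> [n = Suc (Suc n)] (mod 3)" for n
    unfolding cong_def by presburger+
  then have ne: "col x \<noteq> col y" and nc: "\<not> [col x = Suc (col y)] (mod 3)"
    using assms(5) cong_trans[OF _ cong_add[OF assms(5) cong_refl[of 1]], of "col x"] by auto
  show ?thesis
    using arc_or[OF assms(1,2) ne] core_step assms nc by blast
qed

lemma walk_in: "(x, y) \<in> E ^^ l \<Longrightarrow> x \<in> X \<Longrightarrow> y \<in> X"
  using arc_in by (induction l arbitrary: y) auto

lemma walk_rank: "(x, y) \<in> E ^^ l \<Longrightarrow> rank x \<le> rank y"
  by (induction l arbitrary: y) (auto dest!: arc_rank intro: order_trans)

text \<open>Ranks never decrease along a walk, so a walk with both ends in the core stays there, and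
  each of its arcs advances the colour by 1.\<close>

lemma core_walk_col:
  "(x, y) \<in> E ^^ l \<Longrightarrow> rank x = t \<Longrightarrow> rank y = t \<Longrightarrow> [col y = col x + l] (mod 3)"
proof (induction l arbitrary: y)
  case (Suc l)
  obtain z where z: "(x, z) \<in> E ^^ l" "(z, y) \<in> E" using relpow_Suc_E[OF Suc.prems(1)] by blast
  then have rz: "rank z = t" using walk_rank arc_rank Suc.prems by (metis le_antisym)
  have "[col z = col x + l] (mod 3)" by (rule Suc.IH) fact+
  moreover have "[col y = Suc (col z)] (mod 3)" by (rule core_step) fact+
  ultimately show ?case
    using cong_trans[OF _ cong_add[OF _ cong_refl[of 1]], of "col y" "col z" 3 "col x + l"] by simp
qed auto

lemma core_residue: "\<exists>y\<in>X. rank y = t \<and> [col y = n] (mod 3)"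
proof -
  have "\<exists>i\<in>{1..3}. [i = n] (mod 3)"
    \<comment> \<open>\<open>(n + 2) mod 3 + 1\<close> is the representative of \<open>n\<close> in
      \<open>{1..3}\<close>.\<close>
    unfolding cong_def by (rule bexI[of _ "(n + 2) mod 3 + 1"]) (auto, presburger)
  then show ?thesis using core_ex by metis
qed

text \<open>Consecutive core classes are completely joined, so the walk may pass through any vertex
  of each next class. The length is positive because an empty walk cannot join two different
  vertices of one class.\<close>

lemma core_walk:
  assumes "x \<in> X" "y \<in> X" "rank x = t" "rank y = t" "[col y = col x + Suc l] (mod 3)"
  shows "(x, y) \<in> E ^^ Suc l"
  using assms
proof (induction l arbitrary: y)
  case 0
  then show ?case using core_arc[of x y] by simp
next
  case (Suc l)
  obtain z where z: "z \<in> X" "rank z = t" "[col z = col x + Suc l] (mod 3)"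
    using core_residue by blast
  have "[col y = Suc (col z)] (mod 3)"
    using cong_trans[OF _ cong_sym[OF cong_add[OF z(3) cong_refl[of 1]]]] Suc.prems(5) by simp
  have "(z, y) \<in> E" by (rule core_arc) fact+
  moreover have "(x, z) \<in> E ^^ Suc l" by (rule Suc.IH) fact+
  ultimately show ?case by (rule relpow_Suc_I[rotated])
qed

text \<open>A walk that enters the core rotates through its three classes from then on, so the part of
  the core reached in exactly \<open>m\<close> steps is governed by residues that do not depend on \<open>m\<close>.\<close>

definition phases :: "'a \<Rightarrow> nat set" where
  "phases v = {p. p < 3 \<and> (\<exists>l y. (v, y) \<in> E ^^ l \<and> rank y = t \<and> [col y = p + l] (mod 3))}"

section \<open>Phases and the prey inside the core\<close>

lemma walk_phase:
  assumes "(v, y) \<in> E ^^ l" "rank y = t"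
  shows "\<exists>p\<in>phases v. [col y = p + l] (mod 3)"
proof -
  \<comment> \<open>\<open>(col y + 2 * l) mod 3\<close> is the residue of \<open>col y - l\<close>,
    written without subtraction.\<close>
  have "[col y = (col y + 2 * l) mod 3 + l] (mod 3)"
    using mod_mult_self2[of "col y" 3 l] by (simp add: cong_def mod_simps)
  then show ?thesis
    using assms unfolding phases_def by (intro bexI[of _ "(col y + 2 * l) mod 3"]) auto
qed

lemma phases_subset: "phases v \<subseteq> {0, 1, 2}"
  unfolding phases_def by auto

text \<open>The end and the length of a walk into the core determine its phase, which is
  \<open>col y - l\<close> modulo 3 for both starting vertices.\<close>

lemma phases_meet:
  assumes "(u, y) \<in> E ^^ l" "(v, y) \<in> E ^^ l" "rank y = t"
  shows "phases u \<inter> phases v \<noteq> {}"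
proof -
  obtain p q where p: "p \<in> phases u" "q \<in> phases v" and "[col y = p + l] (mod 3)" "[col y = q + l] (mod 3)"
    using walk_phase assms by metis
  then have "[p + l = q + l] (mod 3)" using cong_trans cong_sym by metis
  then have "[p = q] (mod 3)" unfolding cong_add_rcancel_nat .
  moreover have "p < 3" "q < 3" using p unfolding phases_def by auto
  ultimately have "p = q" by (rule cong_less_modulus_unique_nat)
  then show ?thesis using p by blast
qed

text \<open>A core vertex reaches the core by the empty walk; an earlier vertex dominates every core
  class of a colour other than its own.\<close>

lemma phases_nonempty:
  assumes "v \<in> X" "rank v \<le> t" shows "phases v \<noteq> {}"
proof (cases "rank v = t")
  case True
  then show ?thesis using walk_phase[of v v 0] by fastforce
next
  case False
  obtain i :: nat where "i \<in> {1..3}" "i \<noteq> col v"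
    by (cases "col v = 1") (use that[of 1] that[of 2] in auto)
  then obtain y where "y \<in> X" "rank y = t" "(v, y) \<in> E"
    using core_ex[of i] arc_ranked[of v] assms False by force
  then show ?thesis using walk_phase[of v y 1] by fastforce
qed

text \<open>One walk is fixed for each vertex and phase; these are finitely many, so a single
  \<open>N\<close> exceeds their lengths. The remaining steps go round the core and can end anywhere
  in the class that the phase determines.\<close>

lemma core_prey:
  "\<exists>N. \<forall>m\<ge>N. \<forall>v\<in>X. \<forall>y\<in>X. rank y = t \<longrightarrow>
     (v, y) \<in> E ^^ m \<longleftrightarrow> (\<exists>p\<in>phases v. [col y = p + m] (mod 3))"
proof -
  have "\<forall>v p. \<exists>l. p \<in> phases v \<longrightarrow> (\<exists>y. (v, y) \<in> E ^^ l \<and> rank y = t \<and> [col y = p + l] (mod 3))"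
    unfolding phases_def by blast
  then obtain len where len: "\<And>v p. p \<in> phases v \<Longrightarrow>
      \<exists>y. (v, y) \<in> E ^^ len v p \<and> rank y = t \<and> [col y = p + len v p] (mod 3)"
    by metis
  have fin: "finite (Sigma X phases)"
    by (intro finite_SigmaI finite_X finite_subset[OF phases_subset]) auto
  \<comment> \<open>\<open>insert 0\<close> makes the maximum range over a nonempty set, and
    \<open>Suc\<close> leaves at least one step inside the core, as \<open>core_walk\<close>
    requires.\<close>
  define N where "N = Suc (Max (insert 0 (case_prod len ` Sigma X phases)))"
  have less: "len v p < N" if "v \<in> X" "p \<in> phases v" for v p
    unfolding N_def less_Suc_eq_le using fin that by (intro Max_ge) force+
  show ?thesis
  proof (intro exI[of _ N] allI ballI impI iffI)
    fix m v y assume "v \<in> X" "rank y = t" "(v, y) \<in> E ^^ m"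
    then show "\<exists>p\<in>phases v. [col y = p + m] (mod 3)" using walk_phase by blast
  next
    fix m v y assume m: "N \<le> m" and v: "v \<in> X" and y: "y \<in> X" "rank y = t"
      and "\<exists>p\<in>phases v. [col y = p + m] (mod 3)"
    then obtain p where p: "p \<in> phases v" "[col y = p + m] (mod 3)" by blast
    obtain x where x: "(v, x) \<in> E ^^ len v p" "rank x = t" "[col x = p + len v p] (mod 3)"
      using len v p by blast
    obtain d where d: "m = len v p + Suc d"
      using less[OF v p(1)] m less_natE[of "len v p" m] by auto
    have "[col x + Suc d = p + m] (mod 3)"
      using cong_add[OF x(3) cong_refl[of "Suc d"]] by (simp add: d add.assoc)
    then have "[col y = col x + Suc d] (mod 3)" by (rule cong_trans[OF p(2) cong_sym])
    then have "(x, y) \<in> E ^^ Suc d" using core_walk[OF walk_in[OF x(1) v] y(1) x(2) y(2)] by blast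
    then show "(v, y) \<in> E ^^ m" using x(1) unfolding d relpow_add by blast
  qed
qed

text \<open>\<open>tail_prey q\<close> is what the core class of colour \<open>q - n\<close> reaches behind the core in
  \<open>n\<close> steps, taken over all \<open>n\<close>.\<close>

definition tail_prey :: "nat \<Rightarrow> 'a set" where
  "tail_prey q = {w. \<exists>x\<in>X. \<exists>l. t < rank x \<and> (x, w) \<in> E ^^ l \<and>
     (\<exists>i\<in>{1..3}. i \<noteq> col x \<and> [q = i + Suc l] (mod 3))}"

section \<open>Walks in the tail and the prey there\<close>

text \<open>A component behind the core is a single vertex and there are no loops, so every arc that
  starts there raises the rank strictly.\<close>

lemma tail_walk_length:
  "(x, y) \<in> E ^^ l \<Longrightarrow> t < rank x \<Longrightarrow> rank x + l \<le> rank y"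
proof (induction l arbitrary: y)
  case (Suc l)
  obtain z where z: "(x, z) \<in> E ^^ l" "(z, y) \<in> E" using relpow_Suc_E[OF Suc.prems(1)] by blast
  have le: "rank x + l \<le> rank z" using Suc.IH z(1) Suc.prems(2) by blast
  moreover have "z \<noteq> y" "z \<in> X" "y \<in> X" using arc_col[OF z(2)] z(2) arc_in by auto
  then have "rank z \<noteq> rank y" using tail_inj[of z y] le Suc.prems(2) by auto
  ultimately show ?case using arc_rank[OF z(2)] by linarith
qed auto

lemma tail_walk_bound:
  assumes "(x, y) \<in> E ^^ l" "t < rank x" "x \<in> X" shows "l < s"
  using tail_walk_length[OF assms(1,2)] rank_le[OF walk_in[OF assms(1,3)]] assms(2) by linarith

text \<open>Isolates the arc \<open>(u, x)\<close> by which the walk enters the tail: the part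
  before it can be rerouted, and the part after it has bounded length.\<close>

lemma walk_leaves:
  assumes "(v, w) \<in> E ^^ m" "rank v \<le> t" "t < rank w"
  shows "\<exists>a u x l. m = a + Suc l \<and> (v, u) \<in> E ^^ a \<and> rank u \<le> t \<and> (u, x) \<in> E \<and> t < rank x
    \<and> (x, w) \<in> E ^^ l"
  using assms
proof (induction m arbitrary: w)
  case (Suc m)
  obtain z where z: "(v, z) \<in> E ^^ m" "(z, w) \<in> E" using relpow_Suc_E[OF Suc.prems(1)] by blast
  show ?case
  proof (cases "rank z \<le> t")
    case True
    then show ?thesis using z Suc.prems(3)
      by (intro exI[of _ m] exI[of _ z] exI[of _ w] exI[of _ 0]) simp
  next
    case False
    then obtain a u x l where "m = a + Suc l" "(v, u) \<in> E ^^ a" "rank u \<le> t" "(u, x) \<in> E"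
      "t < rank x" "(x, z) \<in> E ^^ l"
      using Suc.IH[OF z(1) Suc.prems(2)] by (auto simp: not_le)
    then show ?thesis using z(2)
      by (intro exI[of _ a] exI[of _ u] exI[of _ x] exI[of _ "Suc l"]) auto
  qed
qed auto

lemma colour_avoiding: obtains i :: nat where "i \<in> {1..3}" "i \<noteq> a" "i \<noteq> b"
proof -
  have "\<not> {1..3} \<subseteq> {a, b}"
    using card_mono[of "{a, b}" "{1..3::nat}"] by (auto simp: card_insert_if split: if_splits)
  then show thesis using that by blast
qed

text \<open>The walk is replaced by one of the same length that enters the tail at \<open>x\<close>
  from a core vertex \<open>y\<close>; the phase of the part ending in \<open>y\<close> then
  accounts for \<open>w\<close>.\<close>

lemma tail_prey_walk:
  assumes "v \<in> X" "rank v \<le> t" "(v, w) \<in> E ^^ m" "t < rank w" "s < m"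
  shows "\<exists>p\<in>phases v. w \<in> tail_prey (p + m)"
proof -
  obtain a u x l where aux: "m = a + Suc l" "(v, u) \<in> E ^^ a" "rank u \<le> t" "(u, x) \<in> E"
      "t < rank x" "(x, w) \<in> E ^^ l"
    using walk_leaves assms by blast
  have xX: "x \<in> X" using aux(4) arc_in by auto
  have "\<exists>y\<in>X. (v, y) \<in> E ^^ a \<and> rank y = t \<and> col y \<noteq> col x"
  proof (cases "rank u = t")
    case True
    then show ?thesis using aux arc_col arc_in by auto
  next
    case False
    text \<open>A long walk that bypasses the core can be rerouted: the predecessor of \<open>u\<close> dominates
      two classes of the core, and one of these dominates \<open>x\<close>.\<close>
    have "l < s" using tail_walk_bound aux xX by blast
    then obtain b where b: "a = Suc b" using assms(5) aux(1) by (cases a) auto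
    then obtain z where z: "(v, z) \<in> E ^^ b" "(z, u) \<in> E" using aux(2) by auto
    have zX: "z \<in> X" "rank z < t" using z arc_in arc_rank[OF z(2)] aux(3) False by auto
    obtain i :: nat where i: "i \<in> {1..3}" "i \<noteq> col x" "i \<noteq> col z" using colour_avoiding .
    then obtain y where y: "y \<in> X" "rank y = t" "col y = i" using core_ex by blast
    then have "(z, y) \<in> E" using arc_ranked zX i by auto
    then show ?thesis using z(1) y i b by auto
  qed
  then obtain y where y: "y \<in> X" "(v, y) \<in> E ^^ a" "rank y = t" "col y \<noteq> col x" by blast
  obtain p where p: "p \<in> phases v" "[col y = p + a] (mod 3)" using walk_phase y by blast
  have "[p + m = col y + Suc l] (mod 3)"
    using cong_add[OF p(2) cong_refl[of "Suc l"]] unfolding aux(1) by (simp add: add.assoc cong_sym)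
  then have "w \<in> tail_prey (p + m)"
    unfolding tail_prey_def using xX aux(5,6) y(4) core_col[OF y(1,3)] by blast
  then show ?thesis using p(1) by blast
qed

text \<open>The threshold \<open>N + s + 1\<close> serves both directions: it exceeds
  \<open>s\<close>, as \<open>tail_prey_walk\<close> requires, and after removing the entry arc and
  a tail walk of length below \<open>s\<close> it still leaves \<open>N\<close> steps for reaching
  the core.\<close>

lemma prey:
  "\<exists>N>s. \<forall>m\<ge>N. \<forall>v\<in>X. \<forall>w\<in>X. rank v \<le> t \<longrightarrow>
     (rank w = t \<longrightarrow> ((v, w) \<in> E ^^ m \<longleftrightarrow> (\<exists>p\<in>phases v. [col w = p + m] (mod 3)))) \<and>
     (t < rank w \<longrightarrow> ((v, w) \<in> E ^^ m \<longleftrightarrow> (\<exists>p\<in>phases v. w \<in> tail_prey (p + m))))"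
proof -
  obtain N where N: "\<And>m v y. N \<le> m \<Longrightarrow> v \<in> X \<Longrightarrow> y \<in> X \<Longrightarrow> rank y = t \<Longrightarrow>
     (v, y) \<in> E ^^ m \<longleftrightarrow> (\<exists>p\<in>phases v. [col y = p + m] (mod 3))"
    using core_prey by blast
  have tail_if: "(v, w) \<in> E ^^ m" if m: "N + s + 1 \<le> m" and v: "v \<in> X" "rank v \<le> t"
    and p: "p \<in> phases v" and w: "w \<in> tail_prey (p + m)" for m v w p
  proof -
    obtain x l i where x: "x \<in> X" "t < rank x" "(x, w) \<in> E ^^ l" and i: "i \<in> {1..3}" "i \<noteq> col x"
      and c: "[p + m = i + Suc l] (mod 3)"
      using w unfolding tail_prey_def by blast
    have "l < s" using tail_walk_bound x by blast
    then obtain a where a: "m = a + Suc l" "N \<le> a"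
      using m by (intro that[of "m - Suc l"]) auto
    obtain y where y: "y \<in> X" "rank y = t" "col y = i" using core_ex i by blast
    have "[col y = p + a] (mod 3)"
      using c unfolding y(3) a(1) add.assoc[symmetric] cong_add_rcancel_nat by (rule cong_sym)
    then have "(v, y) \<in> E ^^ a" using N[OF a(2) v(1) y(1,2)] p by blast
    moreover have "(y, x) \<in> E" using arc_ranked[OF y(1) x(1)] x(2) y(2,3) i(2) by simp
    ultimately have "(v, x) \<in> E ^^ Suc a" by (rule relpow_Suc_I)
    then have "(v, w) \<in> E ^^ (Suc a + l)" using x(3) unfolding relpow_add by blast
    then show ?thesis using a(1) by simp
  qed
  have tail: "(v, w) \<in> E ^^ m \<longleftrightarrow> (\<exists>p\<in>phases v. w \<in> tail_prey (p + m))"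
    if "N + s + 1 \<le> m" "v \<in> X" "rank v \<le> t" "t < rank w" for m v w
  proof
    assume "(v, w) \<in> E ^^ m"
    then show "\<exists>p\<in>phases v. w \<in> tail_prey (p + m)"
      using tail_prey_walk[of v w m] that by simp
  qed (use tail_if[OF that(1-3)] in blast)
  show ?thesis
  proof (intro exI[of _ "N + s + 1"] conjI allI ballI impI)
    fix m v w
    assume *: "N + s + 1 \<le> m" "v \<in> X" "w \<in> X" "rank v \<le> t"
    show "(v, w) \<in> E ^^ m \<longleftrightarrow> (\<exists>p\<in>phases v. [col w = p + m] (mod 3))" if "rank w = t"
      using N[of m v w] * that by simp
    show "(v, w) \<in> E ^^ m \<longleftrightarrow> (\<exists>p\<in>phases v. w \<in> tail_prey (p + m))" if "t < rank w"
      using tail * that by simp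
  qed simp
qed

text \<open>A common prey in the core or before it forces a common phase, so vertices without a
  common phase can share prey only in the tail.\<close>

lemma common_prey:
  "\<exists>N>s. \<forall>m\<ge>N. \<forall>u\<in>X. \<forall>v\<in>X. rank u \<le> t \<longrightarrow> rank v \<le> t \<longrightarrow>
     (\<exists>w. (u, w) \<in> E ^^ m \<and> (v, w) \<in> E ^^ m) \<longleftrightarrow>
     (\<exists>p\<in>phases u. \<exists>p'\<in>phases v. p = p' \<or> tail_prey (p + m) \<inter> tail_prey (p' + m) \<noteq> {})"
proof -
  obtain N where "s < N" and N': "\<forall>m\<ge>N. \<forall>v\<in>X. \<forall>w\<in>X. rank v \<le> t \<longrightarrow>
     (rank w = t \<longrightarrow> ((v, w) \<in> E ^^ m \<longleftrightarrow> (\<exists>p\<in>phases v. [col w = p + m] (mod 3)))) \<and>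
     (t < rank w \<longrightarrow> ((v, w) \<in> E ^^ m \<longleftrightarrow> (\<exists>p\<in>phases v. w \<in> tail_prey (p + m))))"
    using prey by metis
  have N: "\<And>m v w. N \<le> m \<Longrightarrow> v \<in> X \<Longrightarrow> w \<in> X \<Longrightarrow> rank v \<le> t \<Longrightarrow> rank w = t \<Longrightarrow>
       (v, w) \<in> E ^^ m \<longleftrightarrow> (\<exists>p\<in>phases v. [col w = p + m] (mod 3))"
     "\<And>m v w. N \<le> m \<Longrightarrow> v \<in> X \<Longrightarrow> w \<in> X \<Longrightarrow> rank v \<le> t \<Longrightarrow> t < rank w \<Longrightarrow>
       (v, w) \<in> E ^^ m \<longleftrightarrow> (\<exists>p\<in>phases v. w \<in> tail_prey (p + m))"
    by (simp_all add: N')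
  have tailX: "w \<in> X \<and> t < rank w" if "w \<in> tail_prey q" for w q
    using that walk_in walk_rank unfolding tail_prey_def by (auto intro: less_le_trans)
  have "\<exists>p\<in>phases u. \<exists>p'\<in>phases v. p = p' \<or> tail_prey (p + m) \<inter> tail_prey (p' + m) \<noteq> {}"
    (is "?R u v m") if m: "N \<le> m" and u: "u \<in> X" "rank u \<le> t" and v: "v \<in> X" "rank v \<le> t"
      and w: "(u, w) \<in> E ^^ m" "(v, w) \<in> E ^^ m" for m u v w
  proof -
    have wX: "w \<in> X" using walk_in w u by blast
    consider "rank w < t" | "rank w = t" | "rank w > t" by linarith
    then show ?thesis
    proof cases
      case 1
      \<comment> \<open>A common prey before the core is pushed one step further into the core;
        \<open>phases_meet\<close> accepts any common length, here \<open>Suc m\<close>.\<close>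
      obtain i :: nat where i: "i \<in> {1..3}" "i \<noteq> col w" using colour_avoiding .
      then obtain y where y: "y \<in> X" "rank y = t" "col y = i" using core_ex by blast
      then have "(w, y) \<in> E" using arc_ranked wX 1 i by auto
      then have "(u, y) \<in> E ^^ Suc m" "(v, y) \<in> E ^^ Suc m" using w by (auto intro: relpow_Suc_I)
      then show ?thesis using phases_meet y(2) by blast
    next
      case 2
      then show ?thesis using phases_meet w by blast
    next
      case 3
      then obtain p p' where "p \<in> phases u" "w \<in> tail_prey (p + m)" "p' \<in> phases v" "w \<in> tail_prey (p' + m)"
        using N(2)[OF m u(1) wX u(2)] N(2)[OF m v(1) wX v(2)] w by blast
      then show ?thesis by blast
    qed
  qed
  moreover have "\<exists>w. (u, w) \<in> E ^^ m \<and> (v, w) \<in> E ^^ m"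
    if m: "N \<le> m" and u: "u \<in> X" "rank u \<le> t" and v: "v \<in> X" "rank v \<le> t"
      and p: "p \<in> phases u" "p' \<in> phases v"
      and or: "p = p' \<or> tail_prey (p + m) \<inter> tail_prey (p' + m) \<noteq> {}" for m u v p p'
    using or
  proof
    assume "p = p'"
    \<comment> \<open>For a shared phase, any core vertex of colour \<open>p + m\<close> modulo 3 is
      a common prey.\<close>
    moreover obtain y where "y \<in> X" "rank y = t" "[col y = p + m] (mod 3)" using core_residue by blast
    ultimately have "(u, y) \<in> E ^^ m" "(v, y) \<in> E ^^ m" using N(1) m u v p by blast+
    then show ?thesis by blast
  next
    assume "tail_prey (p + m) \<inter> tail_prey (p' + m) \<noteq> {}"
    then obtain w where "w \<in> tail_prey (p + m)" "w \<in> tail_prey (p' + m)" by blast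
    then have "(u, w) \<in> E ^^ m" "(v, w) \<in> E ^^ m" using N(2) m u v p tailX by blast+
    then show ?thesis by blast
  qed
  ultimately have "(\<exists>w. (u, w) \<in> E ^^ m \<and> (v, w) \<in> E ^^ m) \<longleftrightarrow> ?R u v m"
    if "N \<le> m" "u \<in> X" "rank u \<le> t" "v \<in> X" "rank v \<le> t" for m u v
    using that by blast
  then show ?thesis using \<open>s < N\<close> by (intro exI[of _ N]) simp
qed

text \<open>Makes the tail vertices isolated in the competition graph for large
  \<open>m\<close>.\<close>

lemma no_long_tail_walk: "v \<in> X \<Longrightarrow> t < rank v \<Longrightarrow> s \<le> m \<Longrightarrow> (v, w) \<notin> E ^^ m"
  using tail_walk_bound by (meson not_less)

end

section \<open>The tail behind the core\<close>

context cyclic_core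
begin

section \<open>Residues excluded by walks in the tail\<close>

text \<open>Exactly one \<open>k\<close> in \<open>{1..3}\<close> satisfies the congruence, so a
  solution other than \<open>c\<close> is missing just when \<open>c\<close> is this
  \<open>k\<close>.\<close>

lemma residue_avoiding:
  "(\<exists>i\<in>{1..3}. i \<noteq> c \<and> [q = i + n] (mod 3)) \<longleftrightarrow> \<not> (c \<in> {1..3} \<and> [q = c + n] (mod 3))"
  for c q n :: nat
proof -
  \<comment> \<open>\<open>(q + 2 * n + 2) mod 3 + 1\<close> represents \<open>q - n\<close> in
    \<open>{1..3}\<close>.\<close>
  have "((q + 2 * n + 2) mod 3 + (1 + n)) mod 3 = (q + 2 * n + 2 + (1 + n)) mod 3"
    by (rule mod_add_left_eq)
  also have "q + 2 * n + 2 + (1 + n) = q + 3 * (n + 1)" by simp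
  finally have "[q = (q + 2 * n + 2) mod 3 + 1 + n] (mod 3)"
    by (simp only: cong_def mod_mult_self2 add.assoc)
  moreover have "(q + 2 * n + 2) mod 3 + 1 \<in> {1..3}" by auto
  ultimately obtain k where k: "k \<in> {1..3}" "[q = k + n] (mod 3)" by blast
  have uniq: "i = k" if "i \<in> {1..3}" "[q = i + n] (mod 3)" for i
  proof -
    have "[i = k] (mod 3)"
      using cong_trans[OF cong_sym[OF that(2)] k(2)] unfolding cong_add_rcancel_nat .
    moreover have "i = 1 \<or> i = 2 \<or> i = 3" "k = 1 \<or> k = 2 \<or> k = 3" using that(1) k(1) by auto
    ultimately show ?thesis by (auto simp: cong_def)
  qed
  show ?thesis using k uniq by metis
qed

text \<open>A tail walk of length \<open>l\<close> from \<open>x\<close> to \<open>w\<close> puts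
  \<open>w\<close> into \<open>tail_prey q\<close> for all \<open>q\<close> outside the residue
  class of \<open>col x + l + 1\<close>, and for all \<open>q\<close> if no core vertex has the
  colour of \<open>x\<close>.\<close>

lemma tail_prey_iff:
  "w \<in> tail_prey q \<longleftrightarrow> (\<exists>x\<in>X. \<exists>l. t < rank x \<and> (x, w) \<in> E ^^ l \<and>
     \<not> (col x \<in> {1..3} \<and> [q = col x + Suc l] (mod 3)))"
  unfolding tail_prey_def residue_avoiding by simp

lemma tail_arc_rank: "(x, y) \<in> E \<Longrightarrow> t < rank x \<Longrightarrow> rank x < rank y"
  using tail_walk_length[of x y 1] by simp

text \<open>Tail vertices of equal colour are joined by no arc, so only empty walks count, and all
  of them exclude the residue of \<open>j + 1\<close>.\<close>

lemma tail_prey_one_colour: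
  assumes "j \<in> {1..3}" "\<And>x. x \<in> X \<Longrightarrow> t < rank x \<Longrightarrow> col x = j"
  shows "tail_prey q = (if [q = j + 1] (mod 3) then {} else {x \<in> X. t < rank x})"
proof -
  have len: "l = 0" if x: "x \<in> X" "t < rank x" "(x, w) \<in> E ^^ l" for x w l
  proof (cases l)
    case (Suc n)
    then obtain z where z: "(x, z) \<in> E" using x(3) by (metis relpow_Suc_E2)
    then have "z \<in> X" "t < rank z" using arc_in tail_arc_rank[of x z] x(2) by auto
    then show ?thesis using assms(2) arc_col[OF z] x by metis
  qed simp
  have "w \<in> tail_prey q \<longleftrightarrow> w \<in> X \<and> t < rank w \<and> \<not> [q = j + 1] (mod 3)" for w
  proof
    assume "w \<in> tail_prey q"
    then obtain x l where x: "x \<in> X" "t < rank x" "(x, w) \<in> E ^^ l"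
      "\<not> (col x \<in> {1..3} \<and> [q = col x + Suc l] (mod 3))"
      unfolding tail_prey_iff by blast
    with len[OF x(1-3)] assms show "w \<in> X \<and> t < rank w \<and> \<not> [q = j + 1] (mod 3)" by auto
  next
    assume w: "w \<in> X \<and> t < rank w \<and> \<not> [q = j + 1] (mod 3)"
    have "(w, w) \<in> E ^^ 0" by simp
    moreover have "\<not> (col w \<in> {1..3} \<and> [q = col w + Suc 0] (mod 3))" using w assms(2) by simp
    ultimately show "w \<in> tail_prey q" unfolding tail_prey_iff using w by blast
  qed
  then show ?thesis by auto
qed

lemma tail_nonempty: "{x \<in> X. t < rank x} \<noteq> {}"
  using rank_surj[of s] t_less_s by auto

text \<open>Colour form of the second case of the theorem; \<open>j mod 3 + 1\<close> is the cyclic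
  successor of \<open>j\<close> in \<open>{1..3}\<close>.\<close>

definition splits_at :: "nat \<Rightarrow> nat \<Rightarrow> bool" where
  "splits_at \<alpha> j \<longleftrightarrow> (\<forall>x\<in>X. t < rank x \<longrightarrow> col x = (if rank x \<le> \<alpha> then j else j mod 3 + 1))"

text \<open>Tail walks have length at most 1. An arc from the first part to a vertex
  \<open>w\<close> of the second excludes the residue of \<open>j + 2\<close>, just as the empty
  walk at \<open>w\<close> does, so arcs contribute nothing new.\<close>

lemma tail_prey_split:
  assumes j: "j \<in> {1..3}" and split: "splits_at \<alpha> j"
  shows "tail_prey q = {x \<in> X. t < rank x \<and>
    (if rank x \<le> \<alpha> then \<not> [q = j + 1] (mod 3) else \<not> [q = j + 2] (mod 3))}"
proof -
  let ?P = "\<lambda>w. (if rank w \<le> \<alpha> then \<not> [q = j + 1] (mod 3) else \<not> [q = j + 2] (mod 3))"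
  have col: "col x = (if rank x \<le> \<alpha> then j else j mod 3 + 1)" if "x \<in> X" "t < rank x" for x
    using split that unfolding splits_at_def by blast
  have j': "j mod 3 + 1 \<in> {1..3}" "[q = j mod 3 + 1 + 1] (mod 3) \<longleftrightarrow> [q = j + 2] (mod 3)"
    by (auto simp: cong_def mod_simps)
  have P: "\<not> (col w \<in> {1..3} \<and> [q = col w + Suc 0] (mod 3)) \<longleftrightarrow> ?P w" if "w \<in> X" "t < rank w" for w
    using col[OF that] j j' by auto
  \<comment> \<open>Equal colours rule out arcs inside a part and ranks increase, so every tail arc
    crosses from the first part to the second, and no two arcs follow each other.\<close>
  have arc: "rank x \<le> \<alpha> \<and> \<alpha> < rank y" if "(x, y) \<in> E" "t < rank x" for x y
    using arc_col[OF that(1)] col[of x] col[of y] tail_arc_rank[OF that] that arc_in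
    by (auto split: if_splits)
  have "w \<in> X \<and> t < rank w \<and> ?P w" if w: "w \<in> tail_prey q" for w
  proof -
    obtain x l where x: "x \<in> X" "t < rank x" "(x, w) \<in> E ^^ l"
      "\<not> (col x \<in> {1..3} \<and> [q = col x + Suc l] (mod 3))"
      using w unfolding tail_prey_iff by blast
    have wX: "w \<in> X" "t < rank w" using walk_in walk_rank[OF x(3)] x by auto
    consider "l = 0" | "l = 1" | n where "l = Suc (Suc n)"
      by (metis One_nat_def old.nat.exhaust)
    then show ?thesis
    proof cases
      case 1
      then show ?thesis using P x wX by simp
    next
      case 2
      then have "(x, w) \<in> E" using x(3) by simp
      then show ?thesis using arc[of x w] x 2 wX col[of x] j by simp
    next
      case 3
      then obtain y z where "(x, y) \<in> E" "(y, z) \<in> E"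
        using x(3) by (metis relpow_Suc_E2)
      then show ?thesis using arc x(2) tail_arc_rank by (meson less_trans not_le)
    qed
  qed
  moreover have "w \<in> tail_prey q" if w: "w \<in> X" "t < rank w" "?P w" for w
  proof -
    have "(w, w) \<in> E ^^ 0" by simp
    then show ?thesis using w P[OF w(1,2)] unfolding tail_prey_iff by blast
  qed
  ultimately show ?thesis by blast
qed

text \<open>Suppose every vertex is missing from some \<open>tail_prey q\<close>. Then tail colours
  lie in \<open>{1..3}\<close>, and every tail arc advances the colour by 1. A third colour would
  close a directed triangle in the acyclic tail; with exactly two colours, one precedes the other,
  which is an excluded split.\<close>

lemma tail_prey_universal:
  assumes "\<not> (\<exists>j\<in>{1,2,3}. \<forall>x\<in>X. t < rank x \<longrightarrow> col x = j)"
    and "\<not> (\<exists>\<alpha>\<in>{t + 1..s - 1}. \<exists>j\<in>{1,2,3}. splits_at \<alpha> j)"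
  shows "\<exists>w. \<forall>q. w \<in> tail_prey q"
proof (rule ccontr)
  assume none: "\<not> ?thesis"
  let ?T = "{x \<in> X. t < rank x}"
  have col: "col w \<in> {1..3}" if w: "w \<in> ?T" for w
  proof (rule ccontr)
    assume "col w \<notin> {1..3}"
    moreover have "(w, w) \<in> E ^^ 0" by simp
    ultimately have "w \<in> tail_prey q" for q using w unfolding tail_prey_iff by blast
    then show False using none by blast
  qed
  have step: "col y = col x mod 3 + 1" if x: "x \<in> ?T" and y: "y \<in> ?T" and xy: "(x, y) \<in> E" for x y
  proof -
    \<comment> \<open>The empty walk at \<open>y\<close> and the arc \<open>(x, y)\<close> must both
      exclude this \<open>q\<close>, so \<open>col y + 1\<close> and \<open>col x + 2\<close> are
      congruent.\<close>
    obtain q where q: "y \<notin> tail_prey q" using none by blast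
    have "(y, y) \<in> E ^^ 0" "(x, y) \<in> E ^^ 1" using xy by auto
    then have "[q = col y + Suc 0] (mod 3)" "[q = col x + Suc 1] (mod 3)"
      using q x y unfolding tail_prey_iff by blast+
    then have "[col y + 1 = col x + 1 + 1] (mod 3)"
      by (metis Suc_eq_plus1 add_Suc_right cong_sym cong_trans One_nat_def)
    then have "[col y = col x + 1] (mod 3)" unfolding cong_add_rcancel_nat .
    moreover have "col x = 1 \<or> col x = 2 \<or> col x = 3" "col y = 1 \<or> col y = 2 \<or> col y = 3"
      using col[OF x] col[OF y] by auto
    ultimately show ?thesis by (auto simp: cong_def)
  qed
  obtain x0 where x0: "x0 \<in> ?T" using tail_nonempty by blast
  moreover have "col x0 \<in> {1, 2, 3}" using col[OF x0] by auto
  ultimately obtain y0 where y0: "y0 \<in> ?T" "col y0 \<noteq> col x0" using assms(1) by blast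
  obtain x y where x: "x \<in> ?T" and y: "y \<in> ?T" and xy: "(x, y) \<in> E"
    using arc_or[of x0 y0] x0 y0 by auto
  define j where "j = col x"
  have j: "j = 1 \<or> j = 2 \<or> j = 3" using col[OF x] unfolding j_def by auto
  have cy: "col y = j mod 3 + 1" using step[OF x y xy] unfolding j_def .
  \<comment> \<open>A vertex \<open>z\<close> of the third colour would force the arcs
    \<open>(y, z)\<close> and \<open>(z, x)\<close>, closing a triangle with \<open>(x, y)\<close>
    against increasing ranks.\<close>
  have two: "col z = j \<or> col z = j mod 3 + 1" if z: "z \<in> ?T" for z
  proof (rule ccontr)
    assume "\<not> ?thesis"
    then have ne: "col z \<noteq> col x" "col z \<noteq> col y" using cy unfolding j_def by auto
    have cz: "col z = 1 \<or> col z = 2 \<or> col z = 3" using col[OF z] by auto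
    have "\<not> col z = col x mod 3 + 1" using ne(2) cy unfolding j_def by simp
    then have zx: "(z, x) \<in> E" using arc_or[of z x] step[OF x z] ne(1) x z by auto
    have "\<not> col y = col z mod 3 + 1" using cz j ne cy unfolding j_def by auto
    then have yz: "(y, z) \<in> E" using arc_or[of z y] step[OF z y] ne(2) y z by auto
    show False using tail_arc_rank[OF xy] tail_arc_rank[OF yz] tail_arc_rank[OF zx] x y z by auto
  qed
  \<comment> \<open>The split point is the last tail rank at which colour \<open>j\<close>
    occurs.\<close>
  define \<alpha> where "\<alpha> = Max (rank ` {a \<in> ?T. col a = j})"
  have fin: "finite (rank ` {a \<in> ?T. col a = j})" using finite_X by simp
  have ge: "rank a \<le> \<alpha>" if "a \<in> ?T" "col a = j" for a
    unfolding \<alpha>_def using fin that by (intro Max_ge) auto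
  have "\<alpha> \<in> rank ` {a \<in> ?T. col a = j}"
    unfolding \<alpha>_def using fin x j_def by (intro Max_in) auto
  then obtain a where a: "a \<in> ?T" "col a = j" "rank a = \<alpha>" by blast
  \<comment> \<open>An arc from \<open>b\<close> to \<open>a\<close> would have to raise the colour
    by 1, but the passage from \<open>j + 1\<close> to \<open>j\<close> raises it by 2 modulo
    3.\<close>
  have less: "\<alpha> < rank b" if b: "b \<in> ?T" "col b = j mod 3 + 1" for b
  proof -
    have "col a \<noteq> col b" "\<not> col a = col b mod 3 + 1" using j a(2) b(2) by auto
    then have "(a, b) \<in> E" using arc_or[of a b] step[OF b(1) a(1)] a(1) b(1) by auto
    then show ?thesis using tail_arc_rank a by blast
  qed
  have "col z = (if rank z \<le> \<alpha> then j else j mod 3 + 1)" if "z \<in> X" "t < rank z" for z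
    using two[of z] ge[of z] less[of z] that by auto
  then have "splits_at \<alpha> j" unfolding splits_at_def by blast
  moreover have "\<alpha> \<in> {t + 1..s - 1}" using a less[OF y cy] rank_le[of y] y by auto
  ultimately show False using assms(2) j by blast
qed

end

section \<open>Competition graphs as relations\<close>

text \<open>The identity is an isomorphism. This suffices for the theorem, because the competition
  graph will be shown equal to the claimed graph.\<close>

lemma digraph_iso_refl_pair:
  assumes "parcs G \<subseteq> pverts G \<times> pverts G"
  shows "digraph_iso (with_proj G) (with_proj G)"
proof -
  let ?f = "\<lparr>iso_verts = id, iso_arcs = id, iso_head = snd, iso_tail = fst\<rparr>"
  have "wf_digraph (with_proj G)" using assms by unfold_locales auto
  then have "pre_digraph.digraph_isomorphism (with_proj G) ?f"
    by (simp add: pre_digraph.digraph_isomorphism_def)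
  moreover have "with_proj G = app_iso ?f (with_proj G)"
    by (simp add: app_iso_def with_proj_def)
  ultimately show ?thesis unfolding digraph_iso_def by blast
qed

text \<open>The condition \<open>u \<in> pverts D\<close> matters for \<open>m = 0\<close>, where
  the relation power is the identity on the whole type.\<close>

lemma awalk_iff_relpow:
  assumes "parcs D \<subseteq> pverts D \<times> pverts D"
  shows "(\<exists>p. pre_digraph.awalk (with_proj D) u p w \<and> length p = m) \<longleftrightarrow>
    u \<in> pverts D \<and> (u, w) \<in> parcs D ^^ m"
proof (induction m arbitrary: u)
  case 0
  show ?case by (auto simp: pre_digraph.awalk_def cas_with_proj_eq)
next
  case (Suc m)
  have "(\<exists>p. pre_digraph.awalk (with_proj D) u p w \<and> length p = Suc m) \<longleftrightarrow>
      (\<exists>v. (u, v) \<in> parcs D \<and> (\<exists>p. pre_digraph.awalk (with_proj D) v p w \<and> length p = m))"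
    (is "?L \<longleftrightarrow> ?R")
  proof
    assume ?L
    then obtain p where p: "pre_digraph.awalk (with_proj D) u p w" "length p = Suc m" by blast
    then obtain e p' where "p = e # p'" by (cases p) auto
    then show ?R using p assms by (cases e) (auto simp: pre_digraph.awalk_def cas_with_proj_eq)
  next
    assume ?R
    then obtain v p where "(u, v) \<in> parcs D" "pre_digraph.awalk (with_proj D) v p w" "length p = m"
      by blast
    then show ?L
      using assms by (intro exI[of _ "(u, v) # p"]) (auto simp: pre_digraph.awalk_def cas_with_proj_eq)
  qed
  also have "\<dots> \<longleftrightarrow> u \<in> pverts D \<and> (u, w) \<in> parcs D ^^ Suc m"
  proof -
    \<comment> \<open>Walks are unfolded here at their first arc, relation powers at the last
      one.\<close>
    have "parcs D ^^ Suc m = parcs D O parcs D ^^ m" by (simp add: relpow_commute)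
    then show ?thesis unfolding Suc.IH using assms by auto
  qed
  finally show ?case .
qed

lemma step_competition_graph_eq:
  assumes "parcs D \<subseteq> pverts D \<times> pverts D"
  shows "step_competition_graph m D = \<lparr> pverts = pverts D, parcs = {(u, v).
    u \<in> pverts D \<and> v \<in> pverts D \<and> u \<noteq> v \<and> (\<exists>w. (u, w) \<in> parcs D ^^ m \<and> (v, w) \<in> parcs D ^^ m)} \<rparr>"
proof -
  have "(\<exists>w p q. pre_digraph.awalk (with_proj D) u p w \<and> length p = m \<and>
            pre_digraph.awalk (with_proj D) v q w \<and> length q = m) \<longleftrightarrow>
      (\<exists>w. (\<exists>p. pre_digraph.awalk (with_proj D) u p w \<and> length p = m) \<and>
           (\<exists>q. pre_digraph.awalk (with_proj D) v q w \<and> length q = m))" for u v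
    by blast
  then show ?thesis unfolding step_competition_graph_def awalk_iff_relpow[OF assms] by auto
qed

section \<open>Phase patterns\<close>

text \<open>The numbering makes \<open>W a\<close>, the set of vertices whose phase set is \<open>phase_pattern a\<close>, agree with
  the numbering in \<^const>\<open>G1_nonadjacent\<close>.\<close>

definition phase_pattern :: "nat \<Rightarrow> nat set" where
  "phase_pattern a = (if a = 1 then {0, 1, 2} else if a = 2 then {1, 2} else if a = 3 then {0, 1}
     else if a = 4 then {0, 2} else if a = 5 then {1} else if a = 6 then {2} else {0})"

lemma atLeastAtMost_1_7: "{1..7} = {1, 2, 3, 4, 5, 6, 7::nat}"
  by auto

text \<open>Coding a pattern as the binary number with its ones at the given phases reduces the
  claim to seven distinct numbers.\<close>

lemma phase_pattern_inj: "inj_on phase_pattern {1..7}"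
proof (rule inj_on_imageI2)
  show "inj_on (sum (\<lambda>p. 2 ^ p) \<circ> phase_pattern :: nat \<Rightarrow> nat) {1..7}"
    unfolding atLeastAtMost_1_7 by (simp add: phase_pattern_def)
qed

lemma phase_pattern_surj:
  assumes "S \<subseteq> {0, 1, 2}" "S \<noteq> {}"
  shows "\<exists>a\<in>{1..7}. phase_pattern a = S"
proof -
  have "S = (if 0 \<in> S then {0} else {}) \<union> ((if 1 \<in> S then {1} else {}) \<union> (if 2 \<in> S then {2} else {}))"
    using assms(1) by auto
  then show ?thesis
    using assms(2) unfolding atLeastAtMost_1_7
    by (cases "0 \<in> S"; cases "1 \<in> S"; cases "2 \<in> S"; simp add: phase_pattern_def insert_commute)
qed

text \<open>For \<open>i \<equiv> m - j + 1\<close> modulo 3, the common prey of the vertices of phase \<open>p\<close> misses the part of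
  the tail in \<open>V j\<close> just for \<open>p = dead_first i\<close> and, in the second case of the theorem, the part in
  \<open>V (j + 1)\<close> just for \<open>p = dead_second i\<close>.\<close>

definition dead_first :: "nat \<Rightarrow> nat" where
  "dead_first i = (if i = 1 then 1 else if i = 2 then 0 else 2)"

definition dead_second :: "nat \<Rightarrow> nat" where
  "dead_second i = (if i = 1 then 2 else if i = 2 then 1 else 0)"

text \<open>The congruence amounts to \<open>i + j \<equiv> m + 1\<close> modulo 3; substituting it
  removes \<open>m\<close> and \<open>j\<close> and leaves a finite check over \<open>i\<close> and
  \<open>p\<close>.\<close>

lemma dead_iff:
  assumes "[int i = int m - int j + 1] (mod 3)" "i \<in> {1, 2, 3}" "p \<in> {0, 1, 2}"
  shows "[p + m = j + 1] (mod 3) \<longleftrightarrow> p = dead_first i" "[p + m = j + 2] (mod 3) \<longleftrightarrow> p = dead_second i"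
proof -
  have "[int i + int j = int m - int j + 1 + int j] (mod 3)"
    by (rule cong_add[OF assms(1) cong_refl])
  then have "[int (i + j) = int (m + 1)] (mod int 3)" by (simp add: add.commute)
  then have "[i + j = m + 1] (mod 3)" unfolding cong_int_iff .
  then have "[p + (i + j) = p + (m + 1)] (mod 3)" by (rule cong_add[OF cong_refl])
  then have c: "[p + m + 1 = p + i + j] (mod 3)" unfolding add.assoc by (rule cong_sym)
  have shift: "[p + m = j + n] (mod 3) \<longleftrightarrow> [p + i = n + 1] (mod 3)" for n
  proof -
    have "[p + m = j + n] (mod 3) \<longleftrightarrow> [p + m + 1 = j + n + 1] (mod 3)"
      unfolding cong_add_rcancel_nat ..
    also have "\<dots> \<longleftrightarrow> [p + i + j = j + n + 1] (mod 3)"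
      using c by (simp only: cong_def)
    also have "j + n + 1 = n + 1 + j" by simp
    also have "[p + i + j = n + 1 + j] (mod 3) \<longleftrightarrow> [p + i = n + 1] (mod 3)"
      unfolding cong_add_rcancel_nat ..
    finally show ?thesis .
  qed
  show "[p + m = j + 1] (mod 3) \<longleftrightarrow> p = dead_first i" unfolding shift
    using assms(2,3) by (elim insertE emptyE; simp add: cong_def dead_first_def)
  show "[p + m = j + 2] (mod 3) \<longleftrightarrow> p = dead_second i" unfolding shift
    using assms(2,3) by (elim insertE emptyE; simp add: cong_def dead_second_def)
qed

section \<open>Adjacency tables of \<open>G1\<close> and \<open>G2\<close>\<close>

text \<open>The right side fails exactly when the patterns are disjoint and one of them is
  \<open>{dead_first i}\<close>. The listed pairs combine this singleton with the three patterns
  that avoid it.\<close>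

lemma G1_nonadjacent_iff:
  assumes "i \<in> {1, 2, 3}" "a \<in> {1..7}" "b \<in> {1..7}"
  shows "{a, b} \<notin> G1_nonadjacent i \<longleftrightarrow>
    (\<exists>p\<in>phase_pattern a. \<exists>q\<in>phase_pattern b. p = q \<or> p \<noteq> dead_first i \<and> q \<noteq> dead_first i)"
  using assms unfolding atLeastAtMost_1_7
  by (elim insertE emptyE)
    (simp_all add: phase_pattern_def G1_nonadjacent_def dead_first_def doubleton_eq_iff ex_disj_distrib)

text \<open>The pairs of different classes joined by the edges that \<open>G2\<close> adds. Of the
  pairs listed for \<open>G1\<close>, the one left over belongs to the phase sets
  \<open>{dead_first i}\<close> and \<open>{dead_second i}\<close>.\<close>

definition G2_restored :: "nat \<Rightarrow> nat set set" where
  "G2_restored i = (if i = 1 then {{5, 4}, {5, 7}} else if i = 2 then {{7, 2}, {7, 6}}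
     else {{6, 3}, {6, 5}})"

text \<open>Distinct phases satisfy neither inequality alternative just when they are
  \<open>dead_first i\<close> and \<open>dead_second i\<close> in some order, so only these two
  singleton patterns stay nonadjacent.\<close>

lemma G2_nonadjacent_iff:
  assumes "i \<in> {1, 2, 3}" "a \<in> {1..7}" "b \<in> {1..7}"
  shows "{a, b} \<notin> G1_nonadjacent i - G2_restored i \<longleftrightarrow>
    (\<exists>p\<in>phase_pattern a. \<exists>q\<in>phase_pattern b. p = q \<or>
       p \<noteq> dead_first i \<and> q \<noteq> dead_first i \<or> p \<noteq> dead_second i \<and> q \<noteq> dead_second i)"
  using assms unfolding atLeastAtMost_1_7
  by (elim insertE emptyE)
    (simp_all add: phase_pattern_def G1_nonadjacent_def G2_restored_def dead_first_def dead_second_def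
      doubleton_eq_iff ex_disj_distrib)

lemma parcs_G2:
  assumes "disjoint_family_on W {1..7}" "i \<in> {1, 2, 3}"
  shows "parcs (G2 i W) = {(u, v). u \<noteq> v \<and> (\<exists>a\<in>{1..7}. \<exists>b\<in>{1..7}.
    u \<in> W a \<and> v \<in> W b \<and> {a, b} \<notin> G1_nonadjacent i - G2_restored i)}"
proof -
  \<comment> \<open>\<open>c\<close> is the class that is joined to \<open>d\<close> and
    \<open>e\<close>, so the three values of \<open>i\<close> are treated at once.\<close>
  define c d e :: nat where "c = (if i = 1 then 5 else if i = 2 then 7 else 6)"
    and "d = (if i = 1 then 4 else if i = 2 then 2 else 3)"
    and "e = (if i = 1 then 7 else if i = 2 then 6 else 5)"
  have cde: "c \<in> {1..7}" "d \<in> {1..7}" "e \<in> {1..7}" "c \<noteq> d" "c \<noteq> e"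
    unfolding c_def d_def e_def by auto
  have R: "G2_restored i = {{c, d}, {c, e}}"
    unfolding G2_restored_def c_def d_def e_def by auto
  have diag: "{a, a} \<notin> G1_nonadjacent i" for a
    by (auto simp: G1_nonadjacent_def doubleton_eq_iff)
  \<comment> \<open>Disjointness keeps the products in \<open>graph_join\<close> free of
    loops.\<close>
  have disj: "W c \<inter> W d = {}" "W c \<inter> W e = {}"
    using assms(1) cde unfolding disjoint_family_on_def by blast+
  have G2: "parcs (G2 i W) = parcs (G1 i W) \<union> parcs (graph_join (complete_graph (W c))
      (graph_union (complete_graph (W d)) (complete_graph (W e))))"
    using assms(2) by (auto simp: G2_def Let_def c_def d_def e_def)
  have join: "(u, v) \<in> parcs (graph_join (complete_graph (W c))
      (graph_union (complete_graph (W d)) (complete_graph (W e)))) \<longleftrightarrow> u \<noteq> v \<and>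
      (u \<in> W c \<and> v \<in> W c \<or> u \<in> W d \<and> v \<in> W d \<or> u \<in> W e \<and> v \<in> W e \<or>
       u \<in> W c \<and> (v \<in> W d \<or> v \<in> W e) \<or> (u \<in> W d \<or> u \<in> W e) \<and> v \<in> W c)" for u v
    using disj by (auto simp: graph_join_def graph_union_def complete_graph_def)
  have "(u, v) \<in> parcs (G2 i W) \<longleftrightarrow> u \<noteq> v \<and> (\<exists>a\<in>{1..7}. \<exists>b\<in>{1..7}.
    u \<in> W a \<and> v \<in> W b \<and> {a, b} \<notin> G1_nonadjacent i - G2_restored i)" (is "?L \<longleftrightarrow> ?R") for u v
  proof
    assume ?L
    then consider "(u, v) \<in> parcs (G1 i W)" | "u \<noteq> v"
      "u \<in> W c \<and> v \<in> W c \<or> u \<in> W d \<and> v \<in> W d \<or> u \<in> W e \<and> v \<in> W e \<or>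
       u \<in> W c \<and> (v \<in> W d \<or> v \<in> W e) \<or> (u \<in> W d \<or> u \<in> W e) \<and> v \<in> W c"
      unfolding G2 Un_iff join by blast
    then show ?R
    proof cases
      case 1
      then show ?thesis unfolding G1_def by auto
    next
      case 2
      moreover have "{d, c} \<in> G2_restored i" "{e, c} \<in> G2_restored i"
        "{c, d} \<in> G2_restored i" "{c, e} \<in> G2_restored i"
        unfolding R by auto
      ultimately show ?thesis using diag cde(1-3) by blast
    qed
  next
    assume ?R
    then obtain a b where ab: "u \<noteq> v" "a \<in> {1..7}" "b \<in> {1..7}" "u \<in> W a" "v \<in> W b"
      "{a, b} \<notin> G1_nonadjacent i \<or> {a, b} \<in> G2_restored i"
      by blast
    from ab(6) show ?L
    proof
      assume "{a, b} \<notin> G1_nonadjacent i"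
      then have "(u, v) \<in> parcs (G1 i W)"
        using ab(1-5) unfolding G1_def pair_pre_digraph.simps mem_Collect_eq case_prod_conv by blast
      then show ?L unfolding G2 by blast
    next
      assume "{a, b} \<in> G2_restored i"
      then have "a = c \<and> b = d \<or> a = d \<and> b = c \<or> a = c \<and> b = e \<or> a = e \<and> b = c"
        unfolding R by (auto simp: doubleton_eq_iff)
      then show ?L using ab unfolding G2 Un_iff join by blast
    qed
  qed
  then show ?thesis by auto
qed

section \<open>The competition graph of a digraph with cyclic core\<close>

context cyclic_core
begin

definition phase_class :: "nat \<Rightarrow> 'a set" where
  "phase_class a = {v \<in> X. rank v \<le> t \<and> phases v = phase_pattern a}"

lemma phase_class_disjoint: "disjoint_family_on phase_class {1..7}"
  using phase_pattern_inj unfolding disjoint_family_on_def phase_class_def inj_on_def by auto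

lemma phase_class_Union: "(\<Union>a\<in>{1..7}. phase_class a) = {v \<in> X. rank v \<le> t}"
proof -
  have "\<exists>a\<in>{1..7}. phases v = phase_pattern a" if "v \<in> X" "rank v \<le> t" for v
    using phase_pattern_surj[OF phases_subset phases_nonempty[OF that]] by force
  then show ?thesis unfolding phase_class_def by blast
qed

text \<open>Separates the two inputs of each case: \<open>R\<close> records which phases share tail
  prey after \<open>m\<close> steps, \<open>F\<close> the resulting adjacency of classes. Tail
  vertices lie in no class and, as \<open>N > s\<close>, have no prey.\<close>

lemma competition_arcs:
  "\<exists>N>0. \<forall>m\<ge>N. \<forall>R F. (\<forall>p\<in>{0,1,2}. \<forall>q\<in>{0,1,2}. tail_prey (p + m) \<inter> tail_prey (q + m) \<noteq> {} \<longleftrightarrow> R p q) \<longrightarrow>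
     (\<forall>a\<in>{1..7}. \<forall>b\<in>{1..7}. F a b \<longleftrightarrow> (\<exists>p\<in>phase_pattern a. \<exists>q\<in>phase_pattern b. p = q \<or> R p q)) \<longrightarrow>
     {(u, v). u \<in> X \<and> v \<in> X \<and> u \<noteq> v \<and> (\<exists>w. (u, w) \<in> E ^^ m \<and> (v, w) \<in> E ^^ m)} =
     {(u, v). u \<noteq> v \<and> (\<exists>a\<in>{1..7}. \<exists>b\<in>{1..7}. u \<in> phase_class a \<and> v \<in> phase_class b \<and> F a b)}"
proof -
  obtain N where "s < N" and N: "\<forall>m\<ge>N. \<forall>u\<in>X. \<forall>v\<in>X. rank u \<le> t \<longrightarrow> rank v \<le> t \<longrightarrow>
     (\<exists>w. (u, w) \<in> E ^^ m \<and> (v, w) \<in> E ^^ m) \<longleftrightarrow>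
     (\<exists>p\<in>phases u. \<exists>p'\<in>phases v. p = p' \<or> tail_prey (p + m) \<inter> tail_prey (p' + m) \<noteq> {})"
    using common_prey by (elim exE conjE) (rule that)
  show ?thesis
  proof (intro exI[of _ N] conjI allI impI)
    fix m R F
    assume m: "N \<le> m"
      and R: "\<forall>p\<in>{0,1,2}. \<forall>q\<in>{0,1,2}. tail_prey (p + m) \<inter> tail_prey (q + m) \<noteq> {} \<longleftrightarrow> R p q"
      and F: "\<forall>a\<in>{1..7}. \<forall>b\<in>{1..7}. F a b \<longleftrightarrow>
        (\<exists>p\<in>phase_pattern a. \<exists>q\<in>phase_pattern b. p = q \<or> R p q)"
    have early: "rank u \<le> t" if "u \<in> X" "(u, w) \<in> E ^^ m" for u w
      using no_long_tail_walk[OF that(1), of m w] that(2) m \<open>s < N\<close> by (cases "rank u \<le> t") auto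
    have eq: "(\<exists>w. (u, w) \<in> E ^^ m \<and> (v, w) \<in> E ^^ m) \<longleftrightarrow> F a b"
      if ab: "a \<in> {1..7}" "b \<in> {1..7}" and u: "u \<in> phase_class a" and v: "v \<in> phase_class b" for u v a b
    proof -
      have uv: "u \<in> X" "rank u \<le> t" "phases u = phase_pattern a"
        "v \<in> X" "rank v \<le> t" "phases v = phase_pattern b"
        using u v unfolding phase_class_def by auto
      have "(\<exists>w. (u, w) \<in> E ^^ m \<and> (v, w) \<in> E ^^ m) \<longleftrightarrow>
        (\<exists>p\<in>phases u. \<exists>p'\<in>phases v. p = p' \<or> tail_prey (p + m) \<inter> tail_prey (p' + m) \<noteq> {})"
        using N[rule_format, OF m uv(1,4,2,5)] .
      also have "\<dots> \<longleftrightarrow> (\<exists>p\<in>phases u. \<exists>p'\<in>phases v. p = p' \<or> R p p')"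
      proof (intro bex_cong refl)
        fix p p' assume "p \<in> phases u" "p' \<in> phases v"
        then have "p \<in> {0,1,2}" "p' \<in> {0,1,2}" using phases_subset by blast+
        then show "p = p' \<or> tail_prey (p + m) \<inter> tail_prey (p' + m) \<noteq> {} \<longleftrightarrow> p = p' \<or> R p p'"
          using R by blast
      qed
      also have "\<dots> \<longleftrightarrow> F a b" using F ab uv by simp
      finally show ?thesis .
    qed
    have cls: "\<exists>a\<in>{1..7}. u \<in> phase_class a" if "u \<in> X" "rank u \<le> t" for u
      using phase_class_Union that by blast
    have sub: "u \<in> X" if "u \<in> phase_class a" for u a
      using that unfolding phase_class_def by blast
    show "{(u, v). u \<in> X \<and> v \<in> X \<and> u \<noteq> v \<and> (\<exists>w. (u, w) \<in> E ^^ m \<and> (v, w) \<in> E ^^ m)} =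
     {(u, v). u \<noteq> v \<and> (\<exists>a\<in>{1..7}. \<exists>b\<in>{1..7}. u \<in> phase_class a \<and> v \<in> phase_class b \<and> F a b)}"
      (is "{(u, v). ?L u v} = {(u, v). ?R u v}")
    proof -
      have "?R u v" if "?L u v" for u v
      proof -
        from that obtain w where w: "(u, w) \<in> E ^^ m" "(v, w) \<in> E ^^ m"
          and uv: "u \<in> X" "v \<in> X" "u \<noteq> v" by blast
        obtain a b where ab: "a \<in> {1..7}" "b \<in> {1..7}" "u \<in> phase_class a" "v \<in> phase_class b"
          using cls[OF uv(1) early[OF uv(1) w(1)]] cls[OF uv(2) early[OF uv(2) w(2)]] by blast
        then have "F a b" using eq[OF ab] w by blast
        then show ?thesis using ab uv by blast
      qed
      moreover have "?L u v" if "?R u v" for u v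
      proof -
        from that obtain a b where ab: "a \<in> {1..7}" "b \<in> {1..7}" "u \<in> phase_class a" "v \<in> phase_class b"
          and "F a b" "u \<noteq> v" by blast
        then show ?thesis using eq[OF ab] sub by blast
      qed
      ultimately show ?thesis by blast
    qed
  qed (use \<open>s < N\<close> in simp)
qed

section \<open>The three cases\<close>

lemma tail_meet_one_colour:
  assumes "j \<in> {1, 2, 3}" "\<And>x. x \<in> X \<Longrightarrow> t < rank x \<Longrightarrow> col x = j"
    and "[int i = int m - int j + 1] (mod 3)" "i \<in> {1, 2, 3}" "p \<in> {0, 1, 2}" "q \<in> {0, 1, 2}"
  shows "tail_prey (p + m) \<inter> tail_prey (q + m) \<noteq> {} \<longleftrightarrow> p \<noteq> dead_first i \<and> q \<noteq> dead_first i"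
proof -
  have j: "j \<in> {1..3}" using assms(1) by auto
  have eq: "tail_prey n = (if [n = j + 1] (mod 3) then {} else {x \<in> X. t < rank x})" for n
    using j assms(2) by (rule tail_prey_one_colour)
  show ?thesis
    unfolding eq dead_iff[OF assms(3,4,5)] dead_iff[OF assms(3,4,6)] using tail_nonempty by simp
qed

lemma tail_meet_split:
  assumes "j \<in> {1, 2, 3}" "splits_at \<alpha> j" "\<alpha> \<in> {t + 1..s - 1}"
    and "[int i = int m - int j + 1] (mod 3)" "i \<in> {1, 2, 3}" "p \<in> {0, 1, 2}" "q \<in> {0, 1, 2}"
  shows "tail_prey (p + m) \<inter> tail_prey (q + m) \<noteq> {} \<longleftrightarrow>
    p \<noteq> dead_first i \<and> q \<noteq> dead_first i \<or> p \<noteq> dead_second i \<and> q \<noteq> dead_second i"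
proof -
  have j: "j \<in> {1..3}" using assms(1) by auto
  \<comment> \<open>\<open>x\<close> and \<open>y\<close> show that both parts of the tail are
    nonempty, because \<open>t < \<alpha> < s\<close>.\<close>
  obtain x where x: "x \<in> X" "rank x = t + 1" using rank_surj[of "t + 1"] t_less_s by auto
  obtain y where y: "y \<in> X" "rank y = s" using rank_surj[of s] t_less_s by auto
  have xy: "t < rank x" "t < rank y" "rank x \<le> \<alpha>" "\<not> rank y \<le> \<alpha>" using x y assms(3) t_less_s by auto
  let ?P = "\<lambda>p w. if rank w \<le> \<alpha> then p \<noteq> dead_first i else p \<noteq> dead_second i"
  have eq: "tail_prey (p + m) = {w \<in> X. t < rank w \<and> ?P p w}" if "p \<in> {0, 1, 2}" for p
    unfolding tail_prey_split[OF j assms(2)] dead_iff[OF assms(4,5) that] ..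
  have "(\<exists>w\<in>X. t < rank w \<and> ?P p w \<and> ?P q w) \<longleftrightarrow>
      p \<noteq> dead_first i \<and> q \<noteq> dead_first i \<or> p \<noteq> dead_second i \<and> q \<noteq> dead_second i" (is "?L \<longleftrightarrow> ?R")
  proof
    assume ?L
    then obtain w where "?P p w" "?P q w" by blast
    then show ?R by (cases "rank w \<le> \<alpha>") auto
  next
    assume ?R
    then show ?L
    proof
      assume "p \<noteq> dead_first i \<and> q \<noteq> dead_first i"
      then show ?L using x xy by (intro bexI[of _ x]) auto
    next
      assume "p \<noteq> dead_second i \<and> q \<noteq> dead_second i"
      then show ?L using y xy by (intro bexI[of _ y]) auto
    qed
  qed
  then show ?thesis unfolding eq[OF assms(6)] eq[OF assms(7)] by blast
qed

text \<open>Each case instantiates \<open>competition_arcs\<close>: \<open>R\<close> tells when the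
  tail prey of two phases meet, and \<open>F\<close> comes from the adjacency tables. In the last
  case a universal prey makes both constantly true.\<close>

lemma competition_graph_cases:
  "\<exists>N>0. \<forall>m\<ge>N.
     (\<forall>j\<in>{1,2,3}. (\<forall>x\<in>X. t < rank x \<longrightarrow> col x = j) \<longrightarrow>
        (\<forall>i\<in>{1,2,3}. [int i = int m - int j + 1] (mod 3) \<longrightarrow>
          {(u, v). u \<in> X \<and> v \<in> X \<and> u \<noteq> v \<and> (\<exists>w. (u, w) \<in> E ^^ m \<and> (v, w) \<in> E ^^ m)}
            = parcs (G1 i phase_class))) \<and>
     (\<forall>\<alpha>\<in>{t + 1..s - 1}. \<forall>j\<in>{1,2,3}. splits_at \<alpha> j \<longrightarrow>
        (\<forall>i\<in>{1,2,3}. [int i = int m - int j + 1] (mod 3) \<longrightarrow>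
          {(u, v). u \<in> X \<and> v \<in> X \<and> u \<noteq> v \<and> (\<exists>w. (u, w) \<in> E ^^ m \<and> (v, w) \<in> E ^^ m)}
            = parcs (G2 i phase_class))) \<and>
     (\<not> (\<exists>j\<in>{1,2,3}. \<forall>x\<in>X. t < rank x \<longrightarrow> col x = j) \<and>
      \<not> (\<exists>\<alpha>\<in>{t + 1..s - 1}. \<exists>j\<in>{1,2,3}. splits_at \<alpha> j) \<longrightarrow>
        {(u, v). u \<in> X \<and> v \<in> X \<and> u \<noteq> v \<and> (\<exists>w. (u, w) \<in> E ^^ m \<and> (v, w) \<in> E ^^ m)}
          = parcs (complete_graph {v \<in> X. rank v \<le> t}))"
proof -
  obtain N where "0 < N" and N0: "\<forall>m\<ge>N. \<forall>R F.
     (\<forall>p\<in>{0,1,2}. \<forall>q\<in>{0,1,2}. tail_prey (p + m) \<inter> tail_prey (q + m) \<noteq> {} \<longleftrightarrow> R p q) \<longrightarrow>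
     (\<forall>a\<in>{1..7}. \<forall>b\<in>{1..7}. F a b \<longleftrightarrow> (\<exists>p\<in>phase_pattern a. \<exists>q\<in>phase_pattern b. p = q \<or> R p q)) \<longrightarrow>
     {(u, v). u \<in> X \<and> v \<in> X \<and> u \<noteq> v \<and> (\<exists>w. (u, w) \<in> E ^^ m \<and> (v, w) \<in> E ^^ m)} =
     {(u, v). u \<noteq> v \<and> (\<exists>a\<in>{1..7}. \<exists>b\<in>{1..7}. u \<in> phase_class a \<and> v \<in> phase_class b \<and> F a b)}"
    using competition_arcs by (elim exE conjE) (rule that)
  note N = N0[THEN spec, THEN mp, THEN spec, THEN spec, THEN mp, THEN mp]
  show ?thesis
  proof (intro exI[of _ N] conjI allI impI ballI)
    fix m i j :: nat
    assume m: "N \<le> m" and j: "j \<in> {1, 2, 3}" and i: "i \<in> {1, 2, 3}"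
      and c: "[int i = int m - int j + 1] (mod 3)"
    let ?A = "{(u, v). u \<in> X \<and> v \<in> X \<and> u \<noteq> v \<and> (\<exists>w. (u, w) \<in> E ^^ m \<and> (v, w) \<in> E ^^ m)}"
    show "?A = parcs (G1 i phase_class)" if *: "\<forall>x\<in>X. t < rank x \<longrightarrow> col x = j"
    proof -
      have "\<forall>p\<in>{0,1,2}. \<forall>q\<in>{0,1,2}. tail_prey (p + m) \<inter> tail_prey (q + m) \<noteq> {} \<longleftrightarrow>
          p \<noteq> dead_first i \<and> q \<noteq> dead_first i"
        using tail_meet_one_colour[OF j _ c i] * by blast
      moreover have "\<forall>a\<in>{1..7}. \<forall>b\<in>{1..7}. {a, b} \<notin> G1_nonadjacent i \<longleftrightarrow>
          (\<exists>p\<in>phase_pattern a. \<exists>q\<in>phase_pattern b. p = q \<or> p \<noteq> dead_first i \<and> q \<noteq> dead_first i)"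
        using G1_nonadjacent_iff[OF i] by blast
      ultimately show ?thesis unfolding G1_def pair_pre_digraph.simps by (rule N[OF m])
    qed
    show "?A = parcs (G2 i phase_class)" if *: "\<alpha> \<in> {t + 1..s - 1}" "splits_at \<alpha> j" for \<alpha>
    proof -
      have "\<forall>p\<in>{0,1,2}. \<forall>q\<in>{0,1,2}. tail_prey (p + m) \<inter> tail_prey (q + m) \<noteq> {} \<longleftrightarrow>
          p \<noteq> dead_first i \<and> q \<noteq> dead_first i \<or> p \<noteq> dead_second i \<and> q \<noteq> dead_second i"
        using tail_meet_split[OF j *(2,1) c i] by blast
      moreover have "\<forall>a\<in>{1..7}. \<forall>b\<in>{1..7}. {a, b} \<notin> G1_nonadjacent i - G2_restored i \<longleftrightarrow>
          (\<exists>p\<in>phase_pattern a. \<exists>q\<in>phase_pattern b. p = q \<or>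
            p \<noteq> dead_first i \<and> q \<noteq> dead_first i \<or> p \<noteq> dead_second i \<and> q \<noteq> dead_second i)"
        using G2_nonadjacent_iff[OF i] by blast
      ultimately show ?thesis unfolding parcs_G2[OF phase_class_disjoint i] by (rule N[OF m])
    qed
  next
    fix m
    assume m: "N \<le> m" and none: "\<not> (\<exists>j\<in>{1,2,3}. \<forall>x\<in>X. t < rank x \<longrightarrow> col x = j) \<and>
      \<not> (\<exists>\<alpha>\<in>{t + 1..s - 1}. \<exists>j\<in>{1,2,3}. splits_at \<alpha> j)"
    obtain w where "\<And>q. w \<in> tail_prey q" using tail_prey_universal none by blast
    then have "\<forall>p\<in>{0,1,2}. \<forall>q\<in>{0,1,2}. tail_prey (p + m) \<inter> tail_prey (q + m) \<noteq> {} \<longleftrightarrow> True"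
      by blast
    moreover have "phase_pattern a \<noteq> {}" for a by (simp add: phase_pattern_def)
    then have "\<forall>a\<in>{1..7}. \<forall>b\<in>{1..7}. True \<longleftrightarrow>
        (\<exists>p\<in>phase_pattern a. \<exists>q\<in>phase_pattern b. p = q \<or> True)"
      by (auto simp: ex_in_conv)
    ultimately have "{(u, v). u \<in> X \<and> v \<in> X \<and> u \<noteq> v \<and> (\<exists>w. (u, w) \<in> E ^^ m \<and> (v, w) \<in> E ^^ m)} =
      {(u, v). u \<noteq> v \<and> (\<exists>a\<in>{1..7}. \<exists>b\<in>{1..7}. u \<in> phase_class a \<and> v \<in> phase_class b \<and> True)}"
      by (rule N[OF m])
    also have "\<dots> = {(u, v). u \<noteq> v \<and> u \<in> (\<Union>a\<in>{1..7}. phase_class a) \<and> v \<in> (\<Union>a\<in>{1..7}. phase_class a)}"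
      by blast
    also have "\<dots> = parcs (complete_graph {v \<in> X. rank v \<le> t})"
      unfolding phase_class_Union complete_graph_def by auto
    finally show "{(u, v). u \<in> X \<and> v \<in> X \<and> u \<noteq> v \<and> (\<exists>w. (u, w) \<in> E ^^ m \<and> (v, w) \<in> E ^^ m)}
          = parcs (complete_graph {v \<in> X. rank v \<le> t})" .
  qed (rule \<open>0 < N\<close>)
qed

end

section \<open>Multipartite tournaments\<close>

text \<open>Replaces a family of sets by an index function; the partite sets yield
  \<open>col\<close> and the strong components yield \<open>rank\<close>.\<close>

lemma partition_index:
  assumes "is_partition n P A"
  obtains f where "\<And>x. x \<in> A \<Longrightarrow> f x \<in> {1..n}"
    and "\<And>i x. i \<in> {1..n} \<Longrightarrow> x \<in> P i \<longleftrightarrow> x \<in> A \<and> f x = i"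
proof -
  have U: "(\<Union>i\<in>{1..n}. P i) = A" and D: "disjoint_family_on P {1..n}"
    using assms unfolding is_partition_def by auto
  have "\<forall>x\<in>A. \<exists>i. i \<in> {1..n} \<and> x \<in> P i" using U by blast
  then obtain f where f: "\<And>x. x \<in> A \<Longrightarrow> f x \<in> {1..n} \<and> x \<in> P (f x)" using bchoice by metis
  have "x \<in> P i \<longleftrightarrow> x \<in> A \<and> f x = i" if i: "i \<in> {1..n}" for i x
  proof
    assume x: "x \<in> P i"
    then have A: "x \<in> A" using U i by blast
    have "f x = i"
    proof (rule ccontr)
      assume "f x \<noteq> i"
      then have "P (f x) \<inter> P i = {}" using D f[OF A] i unfolding disjoint_family_on_def by blast
      then show False using f[OF A] x by blast
    qed
    then show "x \<in> A \<and> f x = i" using A by blast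
  qed (use f in blast)
  then show thesis using that f by blast
qed

text \<open>Every vertex lies in its own component \<open>scc_of v\<close>, and different components
  have disjoint vertex sets; this makes \<open>partition_index\<close> applicable to ranks.\<close>

lemma (in wf_digraph) sccs_partition:
  assumes "bij_betw Q {1..n} sccs"
  shows "is_partition n (\<lambda>i. verts (Q i)) (verts G)"
proof -
  have img: "Q ` {1..n} = sccs" and inj: "inj_on Q {1..n}" using assms unfolding bij_betw_def by auto
  have in_sccs: "Q i \<in> sccs" if "i \<in> {1..n}" for i using img that by blast
  then have vs: "verts (Q i) \<in> sccs_verts" if "i \<in> {1..n}" for i
    using sccs_verts_conv that by blast
  have nonempty: "verts (Q i) \<noteq> {}" if "i \<in> {1..n}" for i
    using vs[OF that] unfolding in_sccs_verts_conv_reachable by blast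
  have disjoint: "verts (Q i) \<inter> verts (Q j) = {}" if ij: "i \<in> {1..n}" "j \<in> {1..n}" "i \<noteq> j" for i j
  proof -
    have "Q i \<noteq> Q j" using inj ij unfolding inj_on_def by blast
    then have "verts (Q i) \<noteq> verts (Q j)"
      using inj_on_verts_sccs in_sccs[OF ij(1)] in_sccs[OF ij(2)] unfolding inj_on_def by blast
    then show ?thesis using sccs_verts_disjoint vs ij by blast
  qed
  have subset: "verts (Q i) \<subseteq> verts G" if "i \<in> {1..n}" for i
    using in_sccs_imp_induced[OF in_sccs[OF that]] by auto
  have cover: "\<exists>i\<in>{1..n}. v \<in> verts (Q i)" if v: "v \<in> verts G" for v
  proof -
    have self: "v \<in> scc_of v" using v unfolding scc_of_def by simp
    have "scc_of v \<in> sccs_verts"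
      unfolding in_sccs_verts_conv_reachable scc_of_def
      using v by (auto intro: reachable_trans)
    then obtain H where "H \<in> sccs" "verts H = scc_of v" unfolding sccs_verts_conv by auto
    then obtain i where "i \<in> {1..n}" "H = Q i" using img by blast
    then show ?thesis using self \<open>verts H = scc_of v\<close> by auto
  qed
  show ?thesis unfolding is_partition_def disjoint_family_on_def
  proof (intro conjI ballI impI)
    show "(\<Union>i\<in>{1..n}. verts (Q i)) = verts G" using subset cover by blast
  qed (use nonempty disjoint in blast)+
qed

text \<open>Components after \<open>t\<close> are single vertices, which gives the acyclic tail; the
  sets of imprimitivity are the traces of the first three partite sets on \<open>Q t\<close>, which
  gives the rotating core.\<close>

lemma cyclic_core_of_tournament:
  fixes D :: "'a pair_pre_digraph"
  assumes k: "k \<ge> 3"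
    and mt: "multipartite_tournament k V D"
    and osc: "ordered_strong_components D s Q"
    and lnc: "last_nontrivial_component s Q t"
    and ii: "imprimitivity_index (Q t) = 3"
    and ts: "t < s"
    and imps: "imprimitivity_sets (Q t) U"
    and VU: "\<forall>i\<in>{1,2,3}. V i \<inter> verts (Q t) = U i"
  obtains col rank where "cyclic_core (parcs D) (pverts D) col rank t s"
    and "\<forall>i\<in>{1..k}. \<forall>x. x \<in> V i \<longleftrightarrow> x \<in> pverts D \<and> col x = i"
    and "\<forall>x\<in>pverts D. rank x \<in> {1..s}"
    and "\<forall>i\<in>{1..s}. \<forall>x. x \<in> verts (Q i) \<longleftrightarrow> x \<in> pverts D \<and> rank x = i"
proof -
  have pd: "pair_digraph D" and part: "is_partition k V (pverts D)"
    and ori: "orientation_of D (complete_multipartite_graph k V)"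
    using mt unfolding multipartite_tournament_def by auto
  interpret D: wf_digraph "with_proj D"
    using pd unfolding wf_digraph_wp_iff pair_digraph_def pair_fin_digraph_def by blast
  have arc_in: "parcs D \<subseteq> pverts D \<times> pverts D"
    using D.tail_in_verts D.head_in_verts by auto
  have fin: "finite (pverts D)"
    using pd unfolding pair_digraph_def pair_fin_digraph_def pair_fin_digraph_axioms_def by blast
  obtain col where col: "\<And>x. x \<in> pverts D \<Longrightarrow> col x \<in> {1..k}"
    "\<And>i x. i \<in> {1..k} \<Longrightarrow> x \<in> V i \<longleftrightarrow> x \<in> pverts D \<and> col x = i"
    by (rule partition_index[OF part]) (rule that; blast)
  have bij: "bij_betw Q {1..s} (D.sccs)"
    and ord: "\<And>i j u v. i \<in> {1..s} \<Longrightarrow> j \<in> {1..s} \<Longrightarrow> j < i \<Longrightarrow> u \<in> verts (Q i) \<Longrightarrow>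
      v \<in> verts (Q j) \<Longrightarrow> (u, v) \<notin> parcs D"
    using osc unfolding ordered_strong_components_def by blast+
  have Qpart: "is_partition s (\<lambda>i. verts (Q i)) (pverts D)"
    using D.sccs_partition[OF bij] by simp
  obtain rank where rank: "\<And>x. x \<in> pverts D \<Longrightarrow> rank x \<in> {1..s}"
    "\<And>i x. i \<in> {1..s} \<Longrightarrow> x \<in> verts (Q i) \<longleftrightarrow> x \<in> pverts D \<and> rank x = i"
    by (rule partition_index[OF Qpart]) (rule that; blast)
  have t: "t \<in> {1..s}" and triv: "\<And>i. t < i \<Longrightarrow> i \<le> s \<Longrightarrow> card (verts (Q i)) = 1"
    using lnc unfolding last_nontrivial_component_def trivial_component_def by auto
  have arcs: "parcs D \<union> (parcs D)\<inverse> = {(u, v). \<exists>i\<in>{1..k}. \<exists>j\<in>{1..k}. i \<noteq> j \<and> u \<in> V i \<and> v \<in> V j}"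
    using ori unfolding orientation_of_def complete_multipartite_graph_def by simp
  have Qt: "induced_subgraph (Q t) (with_proj D)"
    using bij t D.in_sccs_imp_induced unfolding bij_betw_def by blast
  have Qt_simps: "tail (Q t) = fst" "head (Q t) = snd"
    using Qt unfolding induced_subgraph_def subgraph_def compatible_def by auto
  have Qt_arcs: "e \<in> arcs (Q t)" if "e \<in> parcs D" "fst e \<in> verts (Q t)" "snd e \<in> verts (Q t)" for e
    using Qt that unfolding induced_subgraph_def by auto
  have U: "is_partition 3 U (verts (Q t))"
    and U_step: "\<And>e. e \<in> arcs (Q t) \<Longrightarrow> \<exists>i\<in>{1..3}. fst e \<in> U i \<and> snd e \<in> U (i mod 3 + 1)"
    using imps unfolding imprimitivity_sets_def ii Qt_simps by auto
  \<comment> \<open>\<open>k \<ge> 3\<close> places the three colours of the core among the indices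
    of the partite sets.\<close>
  have UV: "x \<in> U i \<longleftrightarrow> x \<in> pverts D \<and> rank x = t \<and> col x = i" if i: "i \<in> {1..3}" for x i
  proof -
    have "i \<in> {1, 2, 3}" "i \<in> {1..k}" using i k by auto
    then show ?thesis using VU rank(2)[OF t] col(2) by blast
  qed
  have core: "cyclic_core (parcs D) (pverts D) col rank t s"
  proof
    show "finite (pverts D)" by (rule fin)
    show "parcs D \<subseteq> pverts D \<times> pverts D" by (rule arc_in)
    show "t < s" by (rule ts)
    show "col x \<noteq> col y" if "(x, y) \<in> parcs D" for x y
    proof -
      have "(x, y) \<in> parcs D \<union> (parcs D)\<inverse>" using that by blast
      then show ?thesis unfolding arcs using col(2) by auto
    qed
    show "(x, y) \<in> parcs D \<or> (y, x) \<in> parcs D"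
      if "x \<in> pverts D" "y \<in> pverts D" "col x \<noteq> col y" for x y
    proof -
      have "col x \<in> {1..k}" "col y \<in> {1..k}" "x \<in> V (col x)" "y \<in> V (col y)"
        using col(1)[OF that(1)] col(1)[OF that(2)] col(2) that by blast+
      then have "(x, y) \<in> parcs D \<union> (parcs D)\<inverse>" unfolding arcs using that(3) by blast
      then show ?thesis by blast
    qed
    show "rank x \<le> s" if "x \<in> pverts D" for x
      using rank(1)[OF that] by simp
    show "\<exists>x\<in>pverts D. rank x = i" if "i \<in> {1..s}" for i
    proof -
      have "verts (Q i) \<noteq> {}" using Qpart that unfolding is_partition_def by blast
      then show ?thesis using rank(2)[OF that] by blast
    qed
    show "rank x \<le> rank y" if "(x, y) \<in> parcs D" for x y
    proof -
      have x: "x \<in> pverts D" and y: "y \<in> pverts D" using that arc_in by auto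
      have "x \<in> verts (Q (rank x))" "y \<in> verts (Q (rank y))"
        using rank(2)[OF rank(1)[OF x]] rank(2)[OF rank(1)[OF y]] x y by auto
      then show ?thesis
        using ord[OF rank(1)[OF x] rank(1)[OF y]] that by (meson not_le)
    qed
    show "x = y" if xy: "x \<in> pverts D" "y \<in> pverts D" "rank x = rank y" "t < rank x" for x y
    proof -
      have r: "rank x \<in> {1..s}" by (rule rank(1)[OF xy(1)])
      obtain z where "verts (Q (rank x)) = {z}"
        using card_1_singletonE[OF triv[OF xy(4)]] r by auto
      moreover have "x \<in> verts (Q (rank x))" "y \<in> verts (Q (rank x))"
        using rank(2)[OF r] xy by auto
      ultimately show ?thesis by simp
    qed
    show "col x \<in> {1..3}" if "x \<in> pverts D" "rank x = t" for x
    proof -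
      have "x \<in> (\<Union>i\<in>{1..3}. U i)"
        using U rank(2)[OF t] that unfolding is_partition_def by blast
      then obtain i where "i \<in> {1..3}" "x \<in> U i" by blast
      then show ?thesis using UV[of i x] by simp
    qed
    show "[col y = Suc (col x)] (mod 3)" if xy: "(x, y) \<in> parcs D" "rank x = t" "rank y = t" for x y
    proof -
      have "x \<in> pverts D" "y \<in> pverts D" using xy arc_in by auto
      then have "(x, y) \<in> arcs (Q t)" using Qt_arcs[of "(x, y)"] rank(2)[OF t] xy by auto
      then obtain i where i: "i \<in> {1..3}" "x \<in> U i" "y \<in> U (i mod 3 + 1)" using U_step by fastforce
      have "i mod 3 + 1 \<in> {1..3}" by auto
      then have "col x = i" "col y = i mod 3 + 1" using UV i by blast+
      then show ?thesis by (simp add: cong_def mod_Suc_eq)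
    qed
    show "\<exists>x\<in>pverts D. rank x = t \<and> col x = i" if "i \<in> {1..3}" for i
    proof -
      have "U i \<noteq> {}" using U that unfolding is_partition_def by blast
      then show ?thesis using UV[OF that] by blast
    qed
  qed
  show thesis by (rule that[OF core]) (use col(2) rank in blast)+
qed

section \<open>Transfer from colours and ranks to the tournament\<close>

theorem theorem2p10:
  fixes D :: "'a pair_pre_digraph"
    and V U :: "nat \<Rightarrow> 'a set"
    and Q :: "nat \<Rightarrow> ('a, 'a \<times> 'a) pre_digraph"
    and k s t :: nat
  assumes "k \<ge> 3" and "s \<ge> 2"
    and "multipartite_tournament k V D"
    and "ordered_strong_components D s Q"
    and "last_nontrivial_component s Q t"
    and "imprimitivity_index (Q t) = 3"
    and "t < s"
    and "imprimitivity_sets (Q t) U"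
    and "\<forall>i\<in>{1,2,3}. V i \<inter> verts (Q t) = U i"
  shows "\<exists>N::nat. N > 0 \<and> (\<exists>W :: nat \<Rightarrow> 'a set.
    disjoint_family_on W {1..7} \<and>
    (\<Union>a\<in>{1..7}. W a) = verts (component_range D Q 1 t) \<and>
    (\<forall>m\<ge>N.
      (\<forall>j\<in>{1,2,3}. verts (component_range D Q (t + 1) s) \<subseteq> V j \<longrightarrow>
        (\<forall>i\<in>{1,2,3}. [int i = int m - int j + 1] (mod 3) \<longrightarrow>
          digraph_iso (with_proj (step_competition_graph m D))
            (with_proj (graph_union (G1 i W)
              (edgeless_graph (verts (component_range D Q (t + 1) s))))))) \<and>
      (\<forall>\<alpha>\<in>{t + 1..s - 1}. \<forall>j\<in>{1,2,3}.
        partite_related k V (verts (component_range D Q (t + 1) \<alpha>)) (U j) \<and>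
        partite_related k V (verts (component_range D Q (\<alpha> + 1) s)) (U (j mod 3 + 1)) \<longrightarrow>
        (\<forall>i\<in>{1,2,3}. [int i = int m - int j + 1] (mod 3) \<longrightarrow>
          digraph_iso (with_proj (step_competition_graph m D))
            (with_proj (graph_union (G2 i W)
              (edgeless_graph (verts (component_range D Q (t + 1) s))))))) \<and>
      (\<not> (\<exists>j\<in>{1,2,3}. verts (component_range D Q (t + 1) s) \<subseteq> V j) \<and>
       \<not> (\<exists>\<alpha>\<in>{t + 1..s - 1}. \<exists>j\<in>{1,2,3}.
            partite_related k V (verts (component_range D Q (t + 1) \<alpha>)) (U j) \<and>
            partite_related k V (verts (component_range D Q (\<alpha> + 1) s)) (U (j mod 3 + 1))) \<longrightarrow>
          digraph_iso (with_proj (step_competition_graph m D))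
            (with_proj (graph_union
              (complete_graph (verts (component_range D Q 1 t)))
              (edgeless_graph (verts (component_range D Q (t + 1) s))))))))"
proof -
  obtain col rank where core: "cyclic_core (parcs D) (pverts D) col rank t s"
    and col_all: "\<forall>i\<in>{1..k}. \<forall>x. x \<in> V i \<longleftrightarrow> x \<in> pverts D \<and> col x = i"
    and rank_all: "\<forall>x\<in>pverts D. rank x \<in> {1..s}"
      "\<forall>i\<in>{1..s}. \<forall>x. x \<in> verts (Q i) \<longleftrightarrow> x \<in> pverts D \<and> rank x = i"
    by (rule cyclic_core_of_tournament[OF assms(1,3-9)])
  note col = col_all[rule_format] and rank = rank_all[rule_format]
  interpret C: cyclic_core "parcs D" "pverts D" col rank t s by (rule core)
  have range: "verts (component_range D Q a b) = {x \<in> pverts D. a \<le> rank x \<and> rank x \<le> b}"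
    if "1 \<le> a" "b \<le> s" for a b
  proof -
    have "x \<in> verts (Q i) \<longleftrightarrow> x \<in> pverts D \<and> rank x = i" if "i \<in> {a..b}" for i x
      using rank(2) \<open>1 \<le> a\<close> \<open>b \<le> s\<close> that by simp
    then show ?thesis unfolding component_range_def induce_subgraph_verts by auto
  qed
  define S where "S = {x \<in> pverts D. rank x \<le> t}"
  define T where "T = {x \<in> pverts D. t < rank x}"
  have S: "verts (component_range D Q 1 t) = S"
    unfolding S_def using range[of 1 t] rank(1) C.t_less_s by auto
  have T: "verts (component_range D Q (t + 1) s) = T"
    unfolding T_def using range[of "t + 1" s] rank(1) by auto
  have T_sub: "T \<subseteq> V j \<longleftrightarrow> (\<forall>x\<in>pverts D. t < rank x \<longrightarrow> col x = j)" if "j \<in> {1, 2, 3}" for j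
    using col[of j] that assms(1) unfolding T_def by auto
  \<comment> \<open>\<open>U j\<close> is nonempty and lies in \<open>V j\<close>, and partite sets
    are disjoint, so \<open>V j\<close> is the only partite set that can contain it.\<close>
  have related: "partite_related k V Z (U j) \<longleftrightarrow> Z \<subseteq> V j" if j: "j \<in> {1, 2, 3}" for Z j
  proof -
    have jk: "j \<in> {1..k}" using j assms(1) by auto
    have "U j \<noteq> {}"
      using assms(8) j unfolding imprimitivity_sets_def is_partition_def assms(6) by auto
    moreover have UV: "U j \<subseteq> V j" using assms(9) j by blast
    moreover have "i = j" if "i \<in> {1..k}" "x \<in> V i" "x \<in> V j" for i x
      using col[OF jk, of x] col[OF that(1), of x] that by simp
    ultimately show ?thesis unfolding partite_related_def using jk by blast
  qed
  have split: "partite_related k V (verts (component_range D Q (t + 1) \<alpha>)) (U j) \<and>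
      partite_related k V (verts (component_range D Q (\<alpha> + 1) s)) (U (j mod 3 + 1)) \<longleftrightarrow>
      C.splits_at \<alpha> j" if j: "j \<in> {1, 2, 3}" and \<alpha>: "\<alpha> \<in> {t + 1..s - 1}" for \<alpha> j
  proof -
    have j': "j mod 3 + 1 \<in> {1, 2, 3}" using j by auto
    have jk: "j \<in> {1..k}" "j mod 3 + 1 \<in> {1..k}" using j j' assms(1) by auto
    have le: "1 \<le> t + 1" "\<alpha> \<le> s" "1 \<le> \<alpha> + 1" "s \<le> s" using \<alpha> by auto
    have "{x \<in> pverts D. t + 1 \<le> rank x \<and> rank x \<le> \<alpha>} \<subseteq> V j \<and>
        {x \<in> pverts D. \<alpha> + 1 \<le> rank x \<and> rank x \<le> s} \<subseteq> V (j mod 3 + 1) \<longleftrightarrow>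
        (\<forall>x\<in>pverts D. (t < rank x \<and> rank x \<le> \<alpha> \<longrightarrow> col x = j) \<and>
          (\<alpha> < rank x \<longrightarrow> col x = j mod 3 + 1))"
      using col[OF jk(1)] col[OF jk(2)] rank(1) by (auto simp: subset_iff Suc_le_eq)
    also have "\<dots> \<longleftrightarrow> C.splits_at \<alpha> j"
      unfolding C.splits_at_def
    proof (intro ball_cong refl)
      fix x
      show "(t < rank x \<and> rank x \<le> \<alpha> \<longrightarrow> col x = j) \<and> (\<alpha> < rank x \<longrightarrow> col x = j mod 3 + 1) \<longleftrightarrow>
          (t < rank x \<longrightarrow> col x = (if rank x \<le> \<alpha> then j else j mod 3 + 1))"
        using \<alpha> by (cases "rank x \<le> \<alpha>") (simp_all add: not_le)
    qed
    finally show ?thesis unfolding related[OF j] related[OF j'] range[OF le(1,2)] range[OF le(3,4)] .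
  qed
  have iso: "digraph_iso (with_proj (step_competition_graph m D))
      (with_proj (graph_union H (edgeless_graph T)))"
    if H: "pverts H = S" "{(u, v). u \<in> pverts D \<and> v \<in> pverts D \<and> u \<noteq> v \<and>
      (\<exists>w. (u, w) \<in> parcs D ^^ m \<and> (v, w) \<in> parcs D ^^ m)} = parcs H" for m H
  proof -
    have "S \<union> T = pverts D" unfolding S_def T_def by auto
    then have eq: "step_competition_graph m D = graph_union H (edgeless_graph T)"
      unfolding step_competition_graph_eq[OF C.arc_in] H(2) graph_union_def edgeless_graph_def
      using H(1) by simp
    have "parcs (step_competition_graph m D) \<subseteq>
        pverts (step_competition_graph m D) \<times> pverts (step_competition_graph m D)"
      unfolding step_competition_graph_eq[OF C.arc_in] by auto
    then show ?thesis unfolding eq by (rule digraph_iso_refl_pair)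
  qed
  have W: "(\<Union>a\<in>{1..7}. C.phase_class a) = S" unfolding S_def by (rule C.phase_class_Union)
  have vs: "pverts (G1 i C.phase_class) = S" "pverts (G2 i C.phase_class) = S"
    "pverts (complete_graph S) = S" for i
    unfolding G2_def G1_def Let_def complete_graph_def by (simp_all only: pair_pre_digraph.simps W)
  obtain N where "0 < N" and N: "\<forall>m\<ge>N.
     (\<forall>j\<in>{1,2,3}. (\<forall>x\<in>pverts D. t < rank x \<longrightarrow> col x = j) \<longrightarrow>
        (\<forall>i\<in>{1,2,3}. [int i = int m - int j + 1] (mod 3) \<longrightarrow>
          {(u, v). u \<in> pverts D \<and> v \<in> pverts D \<and> u \<noteq> v \<and>
            (\<exists>w. (u, w) \<in> parcs D ^^ m \<and> (v, w) \<in> parcs D ^^ m)}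
            = parcs (G1 i C.phase_class))) \<and>
     (\<forall>\<alpha>\<in>{t + 1..s - 1}. \<forall>j\<in>{1,2,3}. C.splits_at \<alpha> j \<longrightarrow>
        (\<forall>i\<in>{1,2,3}. [int i = int m - int j + 1] (mod 3) \<longrightarrow>
          {(u, v). u \<in> pverts D \<and> v \<in> pverts D \<and> u \<noteq> v \<and>
            (\<exists>w. (u, w) \<in> parcs D ^^ m \<and> (v, w) \<in> parcs D ^^ m)}
            = parcs (G2 i C.phase_class))) \<and>
     (\<not> (\<exists>j\<in>{1,2,3}. \<forall>x\<in>pverts D. t < rank x \<longrightarrow> col x = j) \<and>
      \<not> (\<exists>\<alpha>\<in>{t + 1..s - 1}. \<exists>j\<in>{1,2,3}. C.splits_at \<alpha> j) \<longrightarrow>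
        {(u, v). u \<in> pverts D \<and> v \<in> pverts D \<and> u \<noteq> v \<and>
            (\<exists>w. (u, w) \<in> parcs D ^^ m \<and> (v, w) \<in> parcs D ^^ m)}
          = parcs (complete_graph S))"
    using C.competition_graph_cases[folded S_def] by (elim exE conjE) (rule that)
  show ?thesis
  \<comment> \<open>The phase classes serve as \<open>W\<close> for every \<open>m\<close>; only
    \<open>i\<close> varies with \<open>m\<close>.\<close>
  proof (intro exI[of _ N] exI[of _ C.phase_class] conjI allI impI)
    show "0 < N" by fact
    show "disjoint_family_on C.phase_class {1..7}" by (rule C.phase_class_disjoint)
    show "(\<Union>a\<in>{1..7}. C.phase_class a) = verts (component_range D Q 1 t)" unfolding S by (rule W)
    fix m
    assume m: "N \<le> m"
    note Nm = N[THEN spec, THEN mp, OF m]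
    show "\<forall>j\<in>{1,2,3}. verts (component_range D Q (t + 1) s) \<subseteq> V j \<longrightarrow>
        (\<forall>i\<in>{1,2,3}. [int i = int m - int j + 1] (mod 3) \<longrightarrow>
          digraph_iso (with_proj (step_competition_graph m D))
            (with_proj (graph_union (G1 i C.phase_class)
              (edgeless_graph (verts (component_range D Q (t + 1) s))))))"
      unfolding T
    proof (intro ballI impI)
      fix j i :: nat
      assume j: "j \<in> {1, 2, 3}" and sub: "T \<subseteq> V j" and i: "i \<in> {1, 2, 3}"
        and c: "[int i = int m - int j + 1] (mod 3)"
      show "digraph_iso (with_proj (step_competition_graph m D))
          (with_proj (graph_union (G1 i C.phase_class) (edgeless_graph T)))"
        by (rule iso[OF vs(1) Nm[THEN conjunct1, rule_format, OF j _ i c]])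
          (use sub T_sub[OF j] in blast)
    qed
    show "\<forall>\<alpha>\<in>{t + 1..s - 1}. \<forall>j\<in>{1,2,3}.
        partite_related k V (verts (component_range D Q (t + 1) \<alpha>)) (U j) \<and>
        partite_related k V (verts (component_range D Q (\<alpha> + 1) s)) (U (j mod 3 + 1)) \<longrightarrow>
        (\<forall>i\<in>{1,2,3}. [int i = int m - int j + 1] (mod 3) \<longrightarrow>
          digraph_iso (with_proj (step_competition_graph m D))
            (with_proj (graph_union (G2 i C.phase_class)
              (edgeless_graph (verts (component_range D Q (t + 1) s))))))"
      unfolding T
    proof (intro ballI impI)
      fix \<alpha> j i :: nat
      assume \<alpha>: "\<alpha> \<in> {t + 1..s - 1}" and j: "j \<in> {1, 2, 3}" and i: "i \<in> {1, 2, 3}"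
        and c: "[int i = int m - int j + 1] (mod 3)"
        and rel: "partite_related k V (verts (component_range D Q (t + 1) \<alpha>)) (U j) \<and>
          partite_related k V (verts (component_range D Q (\<alpha> + 1) s)) (U (j mod 3 + 1))"
      have "C.splits_at \<alpha> j" using rel unfolding split[OF j \<alpha>] .
      then show "digraph_iso (with_proj (step_competition_graph m D))
          (with_proj (graph_union (G2 i C.phase_class) (edgeless_graph T)))"
        by (intro iso[OF vs(2) Nm[THEN conjunct2, THEN conjunct1, rule_format, OF \<alpha> j _ i c]])
    qed
    assume none: "\<not> (\<exists>j\<in>{1,2,3}. verts (component_range D Q (t + 1) s) \<subseteq> V j) \<and>
       \<not> (\<exists>\<alpha>\<in>{t + 1..s - 1}. \<exists>j\<in>{1,2,3}.
            partite_related k V (verts (component_range D Q (t + 1) \<alpha>)) (U j) \<and>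
            partite_related k V (verts (component_range D Q (\<alpha> + 1) s)) (U (j mod 3 + 1)))"
    show "digraph_iso (with_proj (step_competition_graph m D))
            (with_proj (graph_union
              (complete_graph (verts (component_range D Q 1 t)))
              (edgeless_graph (verts (component_range D Q (t + 1) s)))))"
      unfolding T S
    proof (intro iso[OF vs(3)] Nm[THEN conjunct2, THEN conjunct2, THEN mp] conjI notI)
      assume "\<exists>j\<in>{1,2,3}. \<forall>x\<in>pverts D. t < rank x \<longrightarrow> col x = j"
      then show False using none T_sub unfolding T by blast
    next
      assume "\<exists>\<alpha>\<in>{t + 1..s - 1}. \<exists>j\<in>{1,2,3}. C.splits_at \<alpha> j"
      then show False using none split by blast
    qed
  qed
qed

end
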